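(* The nontrivial commutation relations of $\mathbb{C}_F[\mathbb{CM}^\#]$ are \[ \alpha\delta=e^{2\imath\theta}\delta\alpha, \] \[ \alpha z=e^{2\imath\theta_A}z\alpha,\quad \alpha\tilde w=e^{2\imath(\theta+\theta_A)}\tilde w\alpha,\quad \alpha w=e^{2\imath\theta_A}w\alpha,\quad \alpha\tilde z=e^{2\imath(\theta+\theta_A)}\tilde z\alpha, \] \[ \delta z=e^{-2\imath(\theta+\theta_B)}z\delta,\quad \delta w=e^{-2\imath\theta_B}w\delta,\quad \delta\tilde w=e^{-2\imath(\theta+\theta_B)}\tilde w\delta,\quad \delta\tilde z=e^{-2\imath\theta_B}\tilde z\delta, \] \[ z\tilde w=e^{2\imath(\theta+\theta_B)}\tilde wz,\quad zw=e^{2\imath\theta_A}wz,\quad z\tilde z=e^{2\imath(\theta+\theta_A+\theta_B)}\tilde zz, \] \[ \tilde ww=e^{2\imath(\theta_A-\theta_B)}w\tilde w,\quad \tilde w\tilde z=e^{2\imath(\theta+\theta_A)}\tilde z\tilde w,\quad w\tilde z=e^{2\imath\theta_B}\tilde zw, \] and similar relations with inverse coefficient when a generator is replaced by its conjugate under $*$. The further (projector) relations of $\mathbb{C}_F[\mathbb{CM}^\#]$ are \[ zz^*+ww^*+\tilde z\tilde z^*+\tilde w\tilde w^*=2(a(1-a)-\alpha\alpha^*-\alpha_3^2), \] \[ (1-2a)\alpha=zw^*+\tilde w\tilde z^*,\qquad (1-2a)\delta=-z^*\tilde w-\tilde z w^*, \] \[ (1-2a)(\alpha_3+\delta_3)=\tilde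 w\tilde w^*-ww^*,\qquad (1-2a)(\alpha_3-\delta_3)=zz^*-\tilde z\tilde z^*, \] and the auxiliary relations \[ \alpha\alpha^*+\alpha_3^2=\delta\delta^*+\delta_3^2, \] \[ (\alpha_3+\delta_3)\begin{pmatrix} z \\ \tilde z \end{pmatrix}=\begin{pmatrix} -\alpha & -e^{-2\imath(\theta+\theta_B)}\delta^* \\ e^{2\imath\theta_B}\delta & \alpha^* \end{pmatrix}\begin{pmatrix} w \\ \tilde w \end{pmatrix}, \] \[ (\alpha_3-\delta_3)\begin{pmatrix} w \\ \tilde w \end{pmatrix}=\begin{pmatrix} -\alpha^* & -e^{-2\imath\theta_B}\delta^* \\ e^{2\imath(\theta+\theta_B)}\delta & \alpha \end{pmatrix}\begin{pmatrix} z \\ \tilde z \end{pmatrix}. \] All of these except the last two matrix relations are exactly the same as the projector relations of the classical commutative algebra $\mathbb{C}[\mathbb{CM}^\#]$ in the corresponding generators.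
   Context: $\mathbb{C}[\mathbb{CM}^\#]$ is the commutative unital $*$-algebra generated by the entries $P^\mu{}_\nu$ ($\mu,\nu=1,\dots,4$) with relations $P^2=P$, $\mathrm{Tr}\,P=2$ and $(P^\mu{}_\nu)^*=P^\nu{}_\mu$. Let $(\theta_{\mu\nu})$ be a real antisymmetric $4\times4$ matrix with all rows and columns summing to zero, and put \[ \theta_A=\theta_{12}+\theta_{23}+\theta_{31},\quad \theta_B=\theta_{23}+\theta_{34}+\theta_{42},\quad \theta=\theta_{13}-\theta_{23}+\theta_{24}-\theta_{14}. \] $\mathbb{C}[\mathbb{CM}^\#]$ is graded by monomials in $t_1^{\pm1},\dots,t_4^{\pm1}$ modulo $t_1t_2t_3t_4=1$, with $P^\mu{}_\nu$ of weight $t_\mu t_\nu^{-1}$. $\mathbb{C}_F[\mathbb{CM}^\#]$ is the same vector space with the same $*$ and the twisted product $f\bullet g=F(\mathrm{wt}f,\mathrm{wt}g)\,fg$ on homogeneous elements, where $F(t^{\vec a},t^{\vec b})=e^{\imath\sum_{\mu,\nu}a_\mu\theta_{\mu\nu}b_\nu}$, $t^{\vec a}=t_1^{a_1}\cdots t_4^{a_4}$. Its generators are taken to be $\hat P^\mu{}_\nu=e^{-\imath\theta_{\mu\nu}}P^\mu{}_\nu$, and named by \[ \hat P=\begin{pmatrix} \hat A & \hat B \\ \hat B^\dagger & \hat D \end{pmatrix},\ \hat B=\begin{pmatrix} z & \tilde w \\ w & \tilde z \end{pmatrix},\ \hat A=\begin{pmatrix} a+\alpha_3 & \alpha \\ \alpha^*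 & a-\alpha_3 \end{pmatrix},\ \hat D=\begin{pmatrix} 1-a+\delta_3 & \delta \\ \delta^* & 1-a-\delta_3 \end{pmatrix}, \] with $a,\alpha_3,\delta_3$ self-adjoint. All products in the claim are the $\bullet$ product. The commutation relations not listed are trivial: $a,\alpha_3,\delta_3$ are central and each matrix-entry generator commutes with its own $*$-conjugate. "Similar relations with inverse coefficient" means: if $xy=\lambda yx$ is listed then $xy^*=\bar\lambda y^*x$ (and likewise $x^*y=\bar\lambda yx^*$).
   Formalization: Two misprints are corrected: the relation for (1-2a)δ reads -z*w̃ - w*z̃ (instead of -z*w̃ - z̃w* ), and the matrix in the last relation, for (α₃-δ₃)(w, w̃), has the opposite overall sign; as printed, both are false. *)

theory Defs
  imports "HOL-Analysis.Analysis" "HOL-Library.Poly_Mapping"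
begin

text \<open>
  Matrix indices live in the four-element type \<^typ>\<open>4\<close>, whose elements are the numerals
  1, 2, 3, 4 (with 4 = 0 in that type).  A monomial in the sixteen variables is an exponent
  function on pairs of indices.
\<close>

type_synonym mono = "(4 \<times> 4) \<Rightarrow>\<^sub>0 nat"
type_synonym cpoly = "mono \<Rightarrow>\<^sub>0 complex"

definition pvar :: "4 \<Rightarrow> 4 \<Rightarrow> cpoly" where
  "pvar \<mu> \<nu> = Poly_Mapping.single (Poly_Mapping.single (\<mu>, \<nu>) 1) 1"

definition prel :: "4 \<Rightarrow> 4 \<Rightarrow> cpoly" where
  "prel \<mu> \<rho> = (\<Sum>\<nu>\<in>UNIV. pvar \<mu> \<nu> * pvar \<nu> \<rho>) - pvar \<mu> \<rho>"

definition trel :: cpoly where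
  "trel = (\<Sum>\<mu>\<in>UNIV. pvar \<mu> \<mu>) - 2"

text \<open>The ideal is the submodule spanned by the relations, for the ring acting on itself.\<close>

definition cm_ideal :: "cpoly set" where
  "cm_ideal = module.span (*) (insert trel (range (\<lambda>(\<mu>, \<rho>). prel \<mu> \<rho>)))"

interpretation cpoly_module: module "(*) :: cpoly \<Rightarrow> cpoly \<Rightarrow> cpoly"
  by unfold_locales (simp_all add: algebra_simps)

lemma ideal_add: "p \<in> cm_ideal \<Longrightarrow> q \<in> cm_ideal \<Longrightarrow> p + q \<in> cm_ideal"
  unfolding cm_ideal_def by (rule cpoly_module.span_add)

lemma ideal_diff: "p \<in> cm_ideal \<Longrightarrow> q \<in> cm_ideal \<Longrightarrow> p - q \<in> cm_ideal"
  unfolding cm_ideal_def by (rule cpoly_module.span_diff)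

lemma ideal_zero: "0 \<in> cm_ideal"
  unfolding cm_ideal_def by (rule cpoly_module.span_zero)

lemma ideal_mult: "p \<in> cm_ideal \<Longrightarrow> q * p \<in> cm_ideal"
  unfolding cm_ideal_def by (rule cpoly_module.span_scale)

lemma ideal_uminus: "p \<in> cm_ideal \<Longrightarrow> - p \<in> cm_ideal"
  using ideal_diff[OF ideal_zero] by simp

lemma ideal_sum: "(\<And>x. x \<in> A \<Longrightarrow> f x \<in> cm_ideal) \<Longrightarrow> sum f A \<in> cm_ideal"
  unfolding cm_ideal_def by (rule cpoly_module.span_sum)

lemma prel_ideal: "prel \<mu> \<rho> \<in> cm_ideal"
  unfolding cm_ideal_def by (rule cpoly_module.span_base) auto

lemma trel_ideal: "trel \<in> cm_ideal"
  unfolding cm_ideal_def by (rule cpoly_module.span_base) auto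

lemma cpoly_sum_singles: "(\<Sum>m\<in>Poly_Mapping.keys p. Poly_Mapping.single m (Poly_Mapping.lookup p m)) = (p :: cpoly)"
proof (rule poly_mapping_eqI)
  fix k
  have "Poly_Mapping.lookup (\<Sum>m\<in>Poly_Mapping.keys p. Poly_Mapping.single m (Poly_Mapping.lookup p m)) k
      = (\<Sum>m\<in>Poly_Mapping.keys p. if m = k then Poly_Mapping.lookup p m else 0)"
    by (simp add: lookup_sum lookup_single when_def)
  also have "\<dots> = Poly_Mapping.lookup p k"
    by (simp add: in_keys_iff)
  finally show "Poly_Mapping.lookup (\<Sum>m\<in>Poly_Mapping.keys p. Poly_Mapping.single m (Poly_Mapping.lookup p m)) k = Poly_Mapping.lookup p k" .
qed

lemma cpoly_induct [case_names single add]: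
  fixes p :: cpoly
  assumes s: "\<And>m c. P (Poly_Mapping.single m c)"
    and a: "\<And>p q. P p \<Longrightarrow> P q \<Longrightarrow> P (p + q)"
  shows "P p"
proof -
  have "P (\<Sum>m\<in>A. Poly_Mapping.single m (Poly_Mapping.lookup p m))" if "finite A" for A
    using that
  proof induction
    case empty
    show ?case using s[of 0 0] by simp
  next
    case (insert x F)
    then show ?case using a[OF s] by simp
  qed
  from this[of "Poly_Mapping.keys p"] show ?thesis by (simp add: cpoly_sum_singles)
qed

lemma ideal_map:
  fixes T :: "cpoly \<Rightarrow> 'a::ab_group_add"
  assumes add: "\<And>p q. T (p + q) = T p + T q"
    and J0: "0 \<in> J" and Jadd: "\<And>x y. x \<in> J \<Longrightarrow> y \<in> J \<Longrightarrow> x + y \<in> J"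
    and pr: "\<And>m c \<mu> \<rho>. T (Poly_Mapping.single m c * prel \<mu> \<rho>) \<in> J"
    and tr: "\<And>m c. T (Poly_Mapping.single m c * trel) \<in> J"
    and p: "p \<in> cm_ideal"
  shows "T p \<in> J"
proof -
  have T0: "T 0 = 0" using add[of 0 0] by simp
  have *: "T (a * r) \<in> J" if "r = trel \<or> r \<in> range (\<lambda>(\<mu>, \<rho>). prel \<mu> \<rho>)" for a r
    using that
    by (induction a rule: cpoly_induct) (auto simp: pr tr add distrib_right intro: Jadd)
  show ?thesis
    using p unfolding cm_ideal_def
  proof (induction rule: cpoly_module.span_induct_alt)
    case base
    then show ?case by (simp add: T0 J0)
  next
    case (step c x y)
    then show ?case using * by (auto simp: add intro!: Jadd)
  qed
qed

text \<open>Evaluation at a matrix of numbers; at a projector of trace two it kills the ideal.\<close>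

definition mono_eval :: "(4 \<Rightarrow> 4 \<Rightarrow> complex) \<Rightarrow> mono \<Rightarrow> complex" where
  "mono_eval v m = (\<Prod>i\<in>UNIV. (case i of (\<mu>, \<nu>) \<Rightarrow> v \<mu> \<nu>) ^ Poly_Mapping.lookup m i)"

definition poly_eval :: "(4 \<Rightarrow> 4 \<Rightarrow> complex) \<Rightarrow> cpoly \<Rightarrow> complex" where
  "poly_eval v p = (\<Sum>m\<in>Poly_Mapping.keys p. Poly_Mapping.lookup p m * mono_eval v m)"

lemma mono_eval_add: "mono_eval v (m + n) = mono_eval v m * mono_eval v n"
  by (simp add: mono_eval_def lookup_add power_add prod.distrib)

lemma mono_eval_0 [simp]: "mono_eval v 0 = 1"
  by (simp add: mono_eval_def)

lemma mono_eval_single: "mono_eval v (Poly_Mapping.single (\<mu>, \<nu>) 1) = v \<mu> \<nu>"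
proof -
  have "mono_eval v (Poly_Mapping.single (\<mu>, \<nu>) 1)
      = (\<Prod>i\<in>UNIV. if i = (\<mu>, \<nu>) then v \<mu> \<nu> else 1)"
    unfolding mono_eval_def by (rule prod.cong) (auto simp: lookup_single when_def)
  then show ?thesis by simp
qed

lemma poly_eval_single [simp]: "poly_eval v (Poly_Mapping.single m c) = c * mono_eval v m"
  by (simp add: poly_eval_def)

lemma poly_eval_add: "poly_eval v (p + q) = poly_eval v p + poly_eval v q"
  unfolding poly_eval_def
  by (rule setsum_keys_plus_distrib) (simp_all add: distrib_right)

lemma poly_eval_diff: "poly_eval v (p - q) = poly_eval v p - poly_eval v q"
  using poly_eval_add[of v "p - q" q] by simp

lemma poly_eval_sum: "poly_eval v (sum f A) = (\<Sum>x\<in>A. poly_eval v (f x))"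
proof -
  have 0: "poly_eval v 0 = 0" by (simp add: poly_eval_def)
  show ?thesis
    by (induction A rule: infinite_finite_induct) (simp_all add: 0 poly_eval_add)
qed

lemma poly_eval_mult: "poly_eval v (p * q) = poly_eval v p * poly_eval v q"
proof (induction p rule: cpoly_induct)
  case (single m c)
  show ?case
    by (induction q rule: cpoly_induct)
      (simp_all add: mult_single mono_eval_add poly_eval_add algebra_simps)
next
  case (add p q)
  then show ?case by (simp add: poly_eval_add algebra_simps)
qed

lemma poly_eval_pvar [simp]: "poly_eval v (pvar \<mu> \<nu>) = v \<mu> \<nu>"
  by (simp add: pvar_def mono_eval_single del: One_nat_def)

lemma poly_eval_1: "poly_eval v 1 = 1"
  using poly_eval_single[of v 0 1] by (simp del: poly_eval_single)

lemma poly_eval_ideal: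
  assumes proj: "\<And>\<mu> \<rho>. (\<Sum>\<nu>\<in>UNIV. v \<mu> \<nu> * v \<nu> \<rho>) = v \<mu> \<rho>" and tr: "(\<Sum>\<mu>\<in>UNIV. v \<mu> \<mu>) = 2"
    and p: "p \<in> cm_ideal"
  shows "poly_eval v p = 0"
proof -
  have 2: "poly_eval v 2 = 2"
    using poly_eval_add[of v 1 1] by (simp add: poly_eval_1)
  have "poly_eval v (prel \<mu> \<rho>) = 0" for \<mu> \<rho>
    by (simp add: prel_def poly_eval_diff poly_eval_sum poly_eval_mult proj)
  moreover have "poly_eval v trel = 0"
    using tr by (simp add: trel_def poly_eval_diff poly_eval_sum 2)
  ultimately have "poly_eval v p \<in> {0}"
    by (intro ideal_map[OF poly_eval_add _ _ _ _ p]) (simp_all add: poly_eval_mult)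
  then show ?thesis by simp
qed

lemma one_notin_ideal: "1 \<notin> cm_ideal"
proof
  assume "1 \<in> cm_ideal"
  then have "poly_eval (\<lambda>\<mu> \<nu>. if \<mu> = \<nu> \<and> (\<mu> = 1 \<or> \<mu> = 2) then 1 else 0) 1 = 0"
    by (rule poly_eval_ideal[rotated 2]) (simp_all add: sum_4 forall_4)
  then show False by (simp add: poly_eval_1)
qed

definition cm_eq :: "cpoly \<Rightarrow> cpoly \<Rightarrow> bool" where
  "cm_eq p q \<longleftrightarrow> p - q \<in> cm_ideal"

lemma equivp_cm_eq: "equivp cm_eq"
proof (rule equivpI)
  show "reflp cm_eq" by (rule reflpI) (simp add: cm_eq_def ideal_zero)
  show "symp cm_eq"
    by (rule sympI) (metis cm_eq_def ideal_uminus minus_diff_eq)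
  show "transp cm_eq"
  proof (rule transpI)
    fix p q r assume "cm_eq p q" "cm_eq q r"
    then have "(p - q) + (q - r) \<in> cm_ideal" unfolding cm_eq_def by (rule ideal_add)
    then show "cm_eq p r" by (simp add: cm_eq_def)
  qed
qed

lemma cm_eqI: "p = q \<Longrightarrow> cm_eq p q"
  by (simp add: cm_eq_def ideal_zero)

quotient_type cm = cpoly / cm_eq
  by (rule equivp_cm_eq)

instantiation cm :: comm_ring_1
begin

lift_definition zero_cm :: cm is 0 .
lift_definition one_cm :: cm is 1 .
lift_definition plus_cm :: "cm \<Rightarrow> cm \<Rightarrow> cm" is "(+)"
  unfolding cm_eq_def by (metis add_diff_add ideal_add)
lift_definition minus_cm :: "cm \<Rightarrow> cm \<Rightarrow> cm" is "(-)"
proof -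
  fix p q r s assume "cm_eq p q" "cm_eq r s"
  then have "(p - q) - (r - s) \<in> cm_ideal" unfolding cm_eq_def by (rule ideal_diff)
  then show "cm_eq (p - r) (q - s)" by (simp add: cm_eq_def algebra_simps)
qed
lift_definition uminus_cm :: "cm \<Rightarrow> cm" is "uminus"
  unfolding cm_eq_def by (metis ideal_uminus minus_diff_minus)
lift_definition times_cm :: "cm \<Rightarrow> cm \<Rightarrow> cm" is "(*)"
proof -
  fix p q r s assume "cm_eq p q" "cm_eq r s"
  then have "r * (p - q) + q * (r - s) \<in> cm_ideal"
    unfolding cm_eq_def by (intro ideal_add ideal_mult)
  then show "cm_eq (p * r) (q * s)" by (simp add: cm_eq_def algebra_simps)
qed

instance
proof
  fix a b c :: cm
  show "a * b * c = a * (b * c)" by transfer (rule cm_eqI, rule mult.assoc)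
  show "a * b = b * a" by transfer (rule cm_eqI, rule mult.commute)
  show "1 * a = a" by transfer (rule cm_eqI, rule mult_1)
  show "(a + b) * c = a * c + b * c" by transfer (rule cm_eqI, rule distrib_right)
  show "a + b + c = a + (b + c)" by transfer (rule cm_eqI, rule add.assoc)
  show "a + b = b + a" by transfer (rule cm_eqI, rule add.commute)
  show "0 + a = a" by transfer (rule cm_eqI, rule add_0)
  show "- a + a = 0" by transfer (rule cm_eqI, rule left_minus)
  show "a - b = a + - b" by transfer (rule cm_eqI, rule diff_conv_add_uminus)
  show "(0::cm) \<noteq> 1"
  proof (transfer, rule notI)
    assume "cm_eq 0 1"
    then have "- (0 - 1) \<in> cm_ideal" unfolding cm_eq_def by (rule ideal_uminus)
    then show False using one_notin_ideal by simp
  qed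
qed

end

lift_definition cm_scale :: "complex \<Rightarrow> cm \<Rightarrow> cm" is "\<lambda>c p. Poly_Mapping.single 0 c * p"
  unfolding cm_eq_def by (metis ideal_mult right_diff_distrib)

lift_definition cm_entry :: "4 \<Rightarrow> 4 \<Rightarrow> cm" is pvar .

definition cm_P :: "cm^4^4" where
  "cm_P = (\<chi> \<mu> \<nu>. cm_entry \<mu> \<nu>)"

text \<open>
  The star operation is the conjugate-linear ring homomorphism exchanging the variables with
  indices \<open>(\<mu>, \<nu>)\<close> and \<open>(\<nu>, \<mu>)\<close>.  The relation that the star of an entry of the projector is the
  transposed entry is built in this way, instead of adjoining separate generators for the stars.
\<close>

definition poly_star :: "cpoly \<Rightarrow> cpoly" where
  "poly_star p
    = (\<Sum>m\<in>Poly_Mapping.keys p. Poly_Mapping.single (Poly_Mapping.map_key prod.swap m) (cnj (Poly_Mapping.lookup p m)))"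

lemma poly_star_single [simp]:
  "poly_star (Poly_Mapping.single m c)
    = Poly_Mapping.single (Poly_Mapping.map_key prod.swap m) (cnj c)"
  by (simp add: poly_star_def)

lemma poly_star_add: "poly_star (p + q) = poly_star p + poly_star q"
  unfolding poly_star_def
  by (rule setsum_keys_plus_distrib) (simp_all add: single_add)

lemma poly_star_diff: "poly_star (p - q) = poly_star p - poly_star q"
  using poly_star_add[of "p - q" q] by simp

lemma poly_star_sum: "poly_star (sum f A) = (\<Sum>x\<in>A. poly_star (f x))"
proof -
  have 0: "poly_star 0 = 0" by (simp add: poly_star_def)
  show ?thesis
    by (induction A rule: infinite_finite_induct) (simp_all add: 0 poly_star_add)
qed

lemma poly_star_mult: "poly_star (p * q) = poly_star p * poly_star q"
proof (induction p rule: cpoly_induct)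
  case (single m c)
  show ?case
    by (induction q rule: cpoly_induct)
      (simp_all add: mult_single map_key_plus poly_star_add algebra_simps)
next
  case (add p q)
  then show ?case by (simp add: poly_star_add algebra_simps)
qed

lemma poly_star_pvar: "poly_star (pvar \<mu> \<nu>) = pvar \<nu> \<mu>"
proof -
  have "Poly_Mapping.map_key prod.swap (Poly_Mapping.single (\<mu>, \<nu>) (1::nat))
      = Poly_Mapping.single (\<nu>, \<mu>) 1"
    using map_key_single[of "prod.swap :: 4 \<times> 4 \<Rightarrow> 4 \<times> 4" "(\<nu>, \<mu>)" "1::nat"] by simp
  then show ?thesis by (simp add: pvar_def)
qed

lemma poly_star_1: "poly_star 1 = 1"
  using poly_star_single[of 0 1] by (simp del: poly_star_single)

lemma poly_star_ideal: "p \<in> cm_ideal \<Longrightarrow> poly_star p \<in> cm_ideal"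
proof -
  have "poly_star (prel \<mu> \<rho>) = prel \<rho> \<mu>" for \<mu> \<rho>
    by (simp add: prel_def poly_star_diff poly_star_sum poly_star_mult poly_star_pvar mult.commute)
  moreover have "poly_star trel = trel"
    using poly_star_add[of 1 1]
    by (simp add: trel_def poly_star_diff poly_star_sum poly_star_pvar poly_star_1)
  ultimately show "p \<in> cm_ideal \<Longrightarrow> poly_star p \<in> cm_ideal"
    using ideal_map[of poly_star cm_ideal p]
    by (simp add: poly_star_add poly_star_mult ideal_zero ideal_add ideal_mult
        prel_ideal trel_ideal)
qed

lift_definition cm_star :: "cm \<Rightarrow> cm" is poly_star
  unfolding cm_eq_def by (metis poly_star_diff poly_star_ideal)

text \<open>
  The weight of a monomial as an exponent vector of the \<open>t\<^sub>\<kappa>\<close>; since the product of the \<open>t\<^sub>\<kappa>\<close> is 1,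
  it only matters up to integer multiples of the all-ones vector.
\<close>

definition wt :: "mono \<Rightarrow> int^4" where
  "wt m = (\<chi> \<kappa>. (\<Sum>\<nu>\<in>UNIV. int (Poly_Mapping.lookup m (\<kappa>, \<nu>))) - (\<Sum>\<mu>\<in>UNIV. int (Poly_Mapping.lookup m (\<mu>, \<kappa>))))"

definition same_wt :: "int^4 \<Rightarrow> int^4 \<Rightarrow> bool" where
  "same_wt a b \<longleftrightarrow> (\<exists>k. \<forall>\<kappa>. a $ \<kappa> = b $ \<kappa> + k)"

definition cm_homog :: "int^4 \<Rightarrow> cm set" where
  "cm_homog a = abs_cm ` {p. \<forall>m\<in>Poly_Mapping.keys p. same_wt (wt m) a}"

definition F :: "real^4^4 \<Rightarrow> int^4 \<Rightarrow> int^4 \<Rightarrow> complex" where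
  "F \<theta> a b = cis (\<Sum>\<mu>\<in>UNIV. \<Sum>\<nu>\<in>UNIV. of_int (a $ \<mu>) * \<theta> $ \<mu> $ \<nu> * of_int (b $ \<nu>))"

text \<open>
  The twisted product is the bilinear extension from monomials; it descends to the quotient because
  the relations are homogeneous.  Its defining property on homogeneous elements is
  \<open>cm_tw_homog\<close> below.
\<close>

definition poly_tw :: "real^4^4 \<Rightarrow> cpoly \<Rightarrow> cpoly \<Rightarrow> cpoly" where
  "poly_tw \<theta> p q = (\<Sum>m\<in>Poly_Mapping.keys p. \<Sum>n\<in>Poly_Mapping.keys q.
     Poly_Mapping.single (m + n) (F \<theta> (wt m) (wt n) * Poly_Mapping.lookup p m * Poly_Mapping.lookup q n))"

lemma poly_tw_single [simp]:
  "poly_tw \<theta> (Poly_Mapping.single m c) (Poly_Mapping.single n d)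
    = Poly_Mapping.single (m + n) (F \<theta> (wt m) (wt n) * c * d)"
  by (simp add: poly_tw_def)

lemma poly_tw_add_left: "poly_tw \<theta> (p + p') q = poly_tw \<theta> p q + poly_tw \<theta> p' q"
  unfolding poly_tw_def
  by (rule setsum_keys_plus_distrib) (simp_all add: algebra_simps single_add sum.distrib)

lemma poly_tw_add_right: "poly_tw \<theta> p (q + q') = poly_tw \<theta> p q + poly_tw \<theta> p q'"
  unfolding poly_tw_def sum.distrib[symmetric]
  by (rule sum.cong[OF refl], rule setsum_keys_plus_distrib)
    (simp_all add: algebra_simps single_add)

lemma poly_tw_diff_left: "poly_tw \<theta> (p - p') q = poly_tw \<theta> p q - poly_tw \<theta> p' q"
  using poly_tw_add_left[of \<theta> "p - p'" p' q] by simp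

lemma poly_tw_diff_right: "poly_tw \<theta> p (q - q') = poly_tw \<theta> p q - poly_tw \<theta> p q'"
  using poly_tw_add_right[of \<theta> p "q - q'" q'] by simp

lemma poly_tw_homog:
  assumes "\<And>m n. m \<in> Poly_Mapping.keys p \<Longrightarrow> n \<in> Poly_Mapping.keys q \<Longrightarrow> F \<theta> (wt m) (wt n) = c"
  shows "poly_tw \<theta> p q = Poly_Mapping.single 0 c * (p * q)"
proof -
  have "Poly_Mapping.single 0 c * (p * q)
      = Poly_Mapping.single 0 c
        * ((\<Sum>m\<in>Poly_Mapping.keys p. Poly_Mapping.single m (Poly_Mapping.lookup p m))
          * (\<Sum>n\<in>Poly_Mapping.keys q. Poly_Mapping.single n (Poly_Mapping.lookup q n)))"
    by (simp add: cpoly_sum_singles)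
  also have "\<dots> = (\<Sum>m\<in>Poly_Mapping.keys p. \<Sum>n\<in>Poly_Mapping.keys q.
      Poly_Mapping.single (m + n) (c * Poly_Mapping.lookup p m * Poly_Mapping.lookup q n))"
    by (subst sum_product) (simp only: sum_distrib_left mult_single add_0 mult.assoc)
  also have "\<dots> = poly_tw \<theta> p q"
    unfolding poly_tw_def by (intro sum.cong refl) (simp add: assms)
  finally show ?thesis ..
qed

lemma wt_add: "wt (m + n) = wt m + wt n"
  by (simp add: wt_def vec_eq_iff lookup_add sum.distrib)

lemma wt_0: "wt 0 = 0"
  by (simp add: wt_def vec_eq_iff)

lemma wt_single: "wt (Poly_Mapping.single (\<mu>, \<nu>) 1) = axis \<mu> 1 - axis \<nu> 1"
proof -
  have 1: "(\<Sum>j\<in>UNIV. int (Poly_Mapping.lookup (Poly_Mapping.single (\<mu>, \<nu>) 1) (\<kappa>, j)))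
      = (\<Sum>j\<in>UNIV. if j = \<nu> then (if \<kappa> = \<mu> then 1 else 0) else 0)" for \<kappa>
    by (rule sum.cong) (auto simp: lookup_single when_def)
  have 2: "(\<Sum>j\<in>UNIV. int (Poly_Mapping.lookup (Poly_Mapping.single (\<mu>, \<nu>) 1) (j, \<kappa>)))
      = (\<Sum>j\<in>UNIV. if j = \<mu> then (if \<kappa> = \<nu> then 1 else 0) else 0)" for \<kappa>
    by (rule sum.cong) (auto simp: lookup_single when_def)
  show ?thesis
    unfolding wt_def vec_eq_iff by (simp only: 1 2) (simp add: axis_def)
qed

lemma keys_mult_wt:
  assumes "\<And>m. m \<in> Poly_Mapping.keys p \<Longrightarrow> wt m = a" "\<And>m. m \<in> Poly_Mapping.keys q \<Longrightarrow> wt m = b"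
    and "m \<in> Poly_Mapping.keys (p * q)"
  shows "wt m = a + b"
proof -
  obtain k l where "m = k + l" "k \<in> Poly_Mapping.keys p" "l \<in> Poly_Mapping.keys q"
    using keys_mult[of p q] assms(3) by blast
  then show ?thesis using assms(1,2) by (simp add: wt_add)
qed

lemma keys_pvar: "m \<in> Poly_Mapping.keys (pvar \<mu> \<nu>) \<Longrightarrow> wt m = axis \<mu> 1 - axis \<nu> 1"
  unfolding pvar_def using wt_single by simp

lemma keys_prel: "m \<in> Poly_Mapping.keys (prel \<mu> \<rho>) \<Longrightarrow> wt m = axis \<mu> 1 - axis \<rho> 1"
proof -
  assume "m \<in> Poly_Mapping.keys (prel \<mu> \<rho>)"
  then have "m \<in> Poly_Mapping.keys (\<Sum>\<nu>\<in>UNIV. pvar \<mu> \<nu> * pvar \<nu> \<rho>) \<or> m \<in> Poly_Mapping.keys (pvar \<mu> \<rho>)"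
    unfolding prel_def
    using keys_diff[of "\<Sum>\<nu>\<in>UNIV. pvar \<mu> \<nu> * pvar \<nu> \<rho>" "pvar \<mu> \<rho>"] by blast
  then consider \<nu> where "m \<in> Poly_Mapping.keys (pvar \<mu> \<nu> * pvar \<nu> \<rho>)" | "m \<in> Poly_Mapping.keys (pvar \<mu> \<rho>)"
    using keys_sum[of "\<lambda>\<nu>. pvar \<mu> \<nu> * pvar \<nu> \<rho>" UNIV] by blast
  then show ?thesis
  proof cases
    case 1
    from keys_mult_wt[OF keys_pvar keys_pvar 1] show ?thesis by simp
  qed (rule keys_pvar)
qed

lemma keys_trel: "m \<in> Poly_Mapping.keys trel \<Longrightarrow> wt m = 0"
proof -
  assume "m \<in> Poly_Mapping.keys trel"
  then have "m \<in> Poly_Mapping.keys (\<Sum>\<mu>\<in>UNIV. pvar \<mu> \<mu>) \<or> m \<in> Poly_Mapping.keys (2 :: cpoly)"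
    unfolding trel_def using keys_diff[of "\<Sum>\<mu>\<in>UNIV. pvar \<mu> \<mu>" 2] by blast
  then consider \<mu> where "m \<in> Poly_Mapping.keys (pvar \<mu> \<mu>)" | "m \<in> Poly_Mapping.keys (2 :: cpoly)"
    using keys_sum[of "\<lambda>\<mu>. pvar \<mu> \<mu>" UNIV] by blast
  then show ?thesis
  proof cases
    case 1
    from keys_pvar[OF this] show ?thesis by simp
  next
    case 2
    have "(2 :: cpoly) = Poly_Mapping.single 0 2" by simp
    then have "m = 0"
      using 2 by (metis emptyE insertE keys_single)
    then show ?thesis by (simp add: wt_0)
  qed
qed

lemma poly_tw_ideal:
  assumes "p \<in> cm_ideal"
  shows "poly_tw \<theta> q p \<in> cm_ideal" "poly_tw \<theta> p q \<in> cm_ideal"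
proof -
  have L: "poly_tw \<theta> (Poly_Mapping.single n d) (Poly_Mapping.single m c * r) \<in> cm_ideal"
    and R: "poly_tw \<theta> (Poly_Mapping.single m c * r) (Poly_Mapping.single n d) \<in> cm_ideal"
    if r: "r \<in> cm_ideal" and b: "\<And>m. m \<in> Poly_Mapping.keys r \<Longrightarrow> wt m = b" for n d m c r b
  proof -
    have k: "wt l = wt m + b" if "l \<in> Poly_Mapping.keys (Poly_Mapping.single m c * r)" for l
      by (rule keys_mult_wt[OF _ b that]) (auto split: if_splits)
    have s: "wt l = wt n" if "l \<in> Poly_Mapping.keys (Poly_Mapping.single n d)" for l
      using that by (auto split: if_splits)
    have "poly_tw \<theta> (Poly_Mapping.single n d) (Poly_Mapping.single m c * r)
      = Poly_Mapping.single 0 (F \<theta> (wt n) (wt m + b))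
        * (Poly_Mapping.single n d * (Poly_Mapping.single m c * r))"
      by (rule poly_tw_homog) (simp only: k s)
    then show "poly_tw \<theta> (Poly_Mapping.single n d) (Poly_Mapping.single m c * r) \<in> cm_ideal"
      using r by (simp add: ideal_mult)
    have "poly_tw \<theta> (Poly_Mapping.single m c * r) (Poly_Mapping.single n d)
      = Poly_Mapping.single 0 (F \<theta> (wt m + b) (wt n))
        * ((Poly_Mapping.single m c * r) * Poly_Mapping.single n d)"
      by (rule poly_tw_homog) (simp only: k s)
    also have "(Poly_Mapping.single m c * r) * Poly_Mapping.single n d
      = Poly_Mapping.single n d * (Poly_Mapping.single m c * r)"
      by (rule mult.commute)
    finally show "poly_tw \<theta> (Poly_Mapping.single m c * r) (Poly_Mapping.single n d) \<in> cm_ideal"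
      using r by (simp add: ideal_mult)
  qed
  show "poly_tw \<theta> q p \<in> cm_ideal"
  proof (induction q rule: cpoly_induct)
    case (single n d)
    show ?case
      by (rule ideal_map[of "poly_tw \<theta> (Poly_Mapping.single n d)" cm_ideal, OF _ _ _ _ _ assms])
        (blast intro: poly_tw_add_right ideal_zero ideal_add
          L[OF prel_ideal keys_prel] L[OF trel_ideal keys_trel])+
  qed (simp add: poly_tw_add_left ideal_add)
  show "poly_tw \<theta> p q \<in> cm_ideal"
  proof (induction q rule: cpoly_induct)
    case (single n d)
    show ?case
      by (rule ideal_map[of "\<lambda>p. poly_tw \<theta> p (Poly_Mapping.single n d)" cm_ideal,
            OF _ _ _ _ _ assms])
        (blast intro: poly_tw_add_left ideal_zero ideal_add
          R[OF prel_ideal keys_prel] R[OF trel_ideal keys_trel])+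
  qed (simp add: poly_tw_add_right ideal_add)
qed

lift_definition cm_tw :: "real^4^4 \<Rightarrow> cm \<Rightarrow> cm \<Rightarrow> cm" is poly_tw
proof -
  fix \<theta> p q r s assume "cm_eq p q" "cm_eq r s"
  then have "poly_tw \<theta> (p - q) r + poly_tw \<theta> q (r - s) \<in> cm_ideal"
    unfolding cm_eq_def by (intro ideal_add poly_tw_ideal)
  then show "cm_eq (poly_tw \<theta> p r) (poly_tw \<theta> q s)"
    by (simp add: cm_eq_def poly_tw_diff_left poly_tw_diff_right)
qed

lemma F_same_wt:
  assumes rows: "\<And>\<mu>. (\<Sum>\<nu>\<in>UNIV. \<theta> $ \<mu> $ \<nu>) = 0" and cols: "\<And>\<nu>. (\<Sum>\<mu>\<in>UNIV. \<theta> $ \<mu> $ \<nu>) = 0"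
    and "same_wt a a'" "same_wt b b'"
  shows "F \<theta> a b = F \<theta> a' b'"
proof -
  obtain k l where k: "\<And>\<kappa>. a $ \<kappa> = a' $ \<kappa> + k" and l: "\<And>\<kappa>. b $ \<kappa> = b' $ \<kappa> + l"
    using assms(3,4) unfolding same_wt_def by blast
  have "(\<Sum>\<mu>\<in>UNIV. \<Sum>\<nu>\<in>UNIV. of_int (a $ \<mu>) * \<theta> $ \<mu> $ \<nu> * of_int (b $ \<nu>))
      = (\<Sum>\<mu>\<in>UNIV. \<Sum>\<nu>\<in>UNIV. of_int (a $ \<mu>) * \<theta> $ \<mu> $ \<nu> * of_int (b' $ \<nu>))
        + (\<Sum>\<mu>\<in>UNIV. of_int (a $ \<mu>) * of_int l * (\<Sum>\<nu>\<in>UNIV. \<theta> $ \<mu> $ \<nu>))"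
    by (simp add: l algebra_simps sum.distrib sum_distrib_left)
  also have "\<dots> = (\<Sum>\<nu>\<in>UNIV. \<Sum>\<mu>\<in>UNIV. of_int (a $ \<mu>) * \<theta> $ \<mu> $ \<nu> * of_int (b' $ \<nu>))"
    by (simp add: rows) (rule sum.swap)
  also have "\<dots> = (\<Sum>\<nu>\<in>UNIV. \<Sum>\<mu>\<in>UNIV. of_int (a' $ \<mu>) * \<theta> $ \<mu> $ \<nu> * of_int (b' $ \<nu>))
        + (\<Sum>\<nu>\<in>UNIV. of_int k * of_int (b' $ \<nu>) * (\<Sum>\<mu>\<in>UNIV. \<theta> $ \<mu> $ \<nu>))"
    by (simp add: k algebra_simps sum.distrib sum_distrib_left)
  also have "\<dots> = (\<Sum>\<mu>\<in>UNIV. \<Sum>\<nu>\<in>UNIV. of_int (a' $ \<mu>) * \<theta> $ \<mu> $ \<nu> * of_int (b' $ \<nu>))"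
    by (simp add: cols) (rule sum.swap)
  finally show ?thesis by (simp add: F_def)
qed

lemma cm_tw_homog:
  assumes "\<And>\<mu>. (\<Sum>\<nu>\<in>UNIV. \<theta> $ \<mu> $ \<nu>) = 0" "\<And>\<nu>. (\<Sum>\<mu>\<in>UNIV. \<theta> $ \<mu> $ \<nu>) = 0"
    and f: "f \<in> cm_homog a" and g: "g \<in> cm_homog b"
  shows "cm_tw \<theta> f g = cm_scale (F \<theta> a b) (f * g)"
proof -
  obtain p where p: "f = abs_cm p" "\<And>m. m \<in> Poly_Mapping.keys p \<Longrightarrow> same_wt (wt m) a"
    using f unfolding cm_homog_def by blast
  obtain q where q: "g = abs_cm q" "\<And>m. m \<in> Poly_Mapping.keys q \<Longrightarrow> same_wt (wt m) b"
    using g unfolding cm_homog_def by blast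
  have "poly_tw \<theta> p q = Poly_Mapping.single 0 (F \<theta> a b) * (p * q)"
    by (rule poly_tw_homog) (rule F_same_wt[OF assms(1,2) p(2) q(2)])
  then show ?thesis
    by (simp add: p(1) q(1) cm_tw.abs_eq cm_scale.abs_eq times_cm.abs_eq)
qed

lemma cm_entry_homog: "cm_entry \<mu> \<nu> \<in> cm_homog (axis \<mu> 1 - axis \<nu> 1)"
proof -
  have "\<forall>m\<in>Poly_Mapping.keys (pvar \<mu> \<nu>). same_wt (wt m) (axis \<mu> 1 - axis \<nu> 1)"
    using keys_pvar unfolding same_wt_def by fastforce
  then show ?thesis
    unfolding cm_homog_def cm_entry.abs_eq by blast
qed

lemma cm_tw_add_left: "cm_tw \<theta> (f + g) h = cm_tw \<theta> f h + cm_tw \<theta> g h"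
  by transfer (simp add: poly_tw_add_left equivp_reflp[OF equivp_cm_eq])

lemma cm_tw_add_right: "cm_tw \<theta> f (g + h) = cm_tw \<theta> f g + cm_tw \<theta> f h"
  by transfer (simp add: poly_tw_add_right equivp_reflp[OF equivp_cm_eq])

definition cm_Phat :: "real^4^4 \<Rightarrow> cm^4^4" where
  "cm_Phat \<theta> = (\<chi> \<mu> \<nu>. cm_scale (cis (- \<theta> $ \<mu> $ \<nu>)) (cm_P $ \<mu> $ \<nu>))"

datatype gen = Ga | Galpha3 | Gdelta3 | Galpha | Gdelta | Gz | Gw | Gzt | Gwt

text \<open>
  The suffixes \<open>zt\<close> and \<open>wt\<close> stand for z and w with a tilde.  \<open>gens_of\<close> solves for the generators
  in the block form \<open>gen_matrix\<close> of the projector; only the upper triangle and the diagonal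
  enter, and the rest is a consequence of the trace and star relations.
\<close>

fun gens_of :: "cm^4^4 \<Rightarrow> gen \<Rightarrow> cm" where
  "gens_of P Ga = cm_scale (1/2) (P $ 1 $ 1 + P $ 2 $ 2)"
| "gens_of P Galpha3 = cm_scale (1/2) (P $ 1 $ 1 - P $ 2 $ 2)"
| "gens_of P Gdelta3 = cm_scale (1/2) (P $ 3 $ 3 - P $ 4 $ 4)"
| "gens_of P Galpha = P $ 1 $ 2"
| "gens_of P Gdelta = P $ 3 $ 4"
| "gens_of P Gz = P $ 1 $ 3"
| "gens_of P Gwt = P $ 1 $ 4"
| "gens_of P Gw = P $ 2 $ 3"
| "gens_of P Gzt = P $ 2 $ 4"

definition gen_matrix :: "(gen \<Rightarrow> cm) \<Rightarrow> cm^4^4" where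
  "gen_matrix g = vector [
     vector [g Ga + g Galpha3,   g Galpha,            g Gz,                      g Gwt],
     vector [cm_star (g Galpha), g Ga - g Galpha3,    g Gw,                      g Gzt],
     vector [cm_star (g Gz),     cm_star (g Gw),      1 - g Ga + g Gdelta3,      g Gdelta],
     vector [cm_star (g Gwt),    cm_star (g Gzt),     cm_star (g Gdelta),        1 - g Ga - g Gdelta3]]"

definition theta_A :: "real^4^4 \<Rightarrow> real" where
  "theta_A \<theta> = \<theta> $ 1 $ 2 + \<theta> $ 2 $ 3 + \<theta> $ 3 $ 1"

definition theta_B :: "real^4^4 \<Rightarrow> real" where
  "theta_B \<theta> = \<theta> $ 2 $ 3 + \<theta> $ 3 $ 4 + \<theta> $ 4 $ 2"

definition theta_0 :: "real^4^4 \<Rightarrow> real" where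
  "theta_0 \<theta> = \<theta> $ 1 $ 3 - \<theta> $ 2 $ 3 + \<theta> $ 2 $ 4 - \<theta> $ 1 $ 4"

locale star_algebra = vector_space scale
  for scale :: "complex \<Rightarrow> 'a::ab_group_add \<Rightarrow> 'a" (infixr \<open>*s\<close> 75) +
  fixes mult :: "'a \<Rightarrow> 'a \<Rightarrow> 'a" (infixl \<open>\<odot>\<close> 72)
    and one :: 'a (\<open>\<one>\<close>)
    and star :: "'a \<Rightarrow> 'a" (\<open>(_\<^sup>\<star>)\<close> [1000] 999)
  assumes mult_assoc: "(x \<odot> y) \<odot> z = x \<odot> (y \<odot> z)"
    and one_left: "\<one> \<odot> x = x"
    and one_right: "x \<odot> \<one> = x"
    and distrib_left': "x \<odot> (y + z) = x \<odot> y + x \<odot> z"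
    and distrib_right': "(x + y) \<odot> z = x \<odot> z + y \<odot> z"
    and scale_mult_left: "(c *s x) \<odot> y = c *s (x \<odot> y)"
    and scale_mult_right: "x \<odot> (c *s y) = c *s (x \<odot> y)"
    and star_star: "(x\<^sup>\<star>)\<^sup>\<star> = x"
    and star_add: "(x + y)\<^sup>\<star> = x\<^sup>\<star> + y\<^sup>\<star>"
    and star_scale: "(c *s x)\<^sup>\<star> = cnj c *s x\<^sup>\<star>"
    and star_mult: "(x \<odot> y)\<^sup>\<star> = y\<^sup>\<star> \<odot> x\<^sup>\<star>"
begin

text \<open>
  A relation together with the ones with inverse coefficient for one conjugated generator; the
  relation for both generators conjugated follows by applying the star to the first.
\<close>

definition qcomm :: "complex \<Rightarrow> 'a \<Rightarrow> 'a \<Rightarrow> bool" where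
  "qcomm c x y \<longleftrightarrow>
     x \<odot> y = c *s (y \<odot> x) \<and>
     x \<odot> y\<^sup>\<star> = cnj c *s (y\<^sup>\<star> \<odot> x) \<and>
     x\<^sup>\<star> \<odot> y = cnj c *s (y \<odot> x\<^sup>\<star>)"

definition commutation_relations :: "real^4^4 \<Rightarrow> (gen \<Rightarrow> 'a) \<Rightarrow> bool" where
  "commutation_relations \<theta>M g \<longleftrightarrow>
    (let \<alpha> = g Galpha; \<delta> = g Gdelta; z = g Gz; w = g Gw; zt = g Gzt; wt = g Gwt;
         \<theta> = theta_0 \<theta>M; \<theta>A = theta_A \<theta>M; \<theta>B = theta_B \<theta>M in
     qcomm (cis (2 * \<theta>)) \<alpha> \<delta> \<and>
     qcomm (cis (2 * \<theta>A)) \<alpha> z \<and>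
     qcomm (cis (2 * (\<theta> + \<theta>A))) \<alpha> wt \<and>
     qcomm (cis (2 * \<theta>A)) \<alpha> w \<and>
     qcomm (cis (2 * (\<theta> + \<theta>A))) \<alpha> zt \<and>
     qcomm (cis (- 2 * (\<theta> + \<theta>B))) \<delta> z \<and>
     qcomm (cis (- 2 * \<theta>B)) \<delta> w \<and>
     qcomm (cis (- 2 * (\<theta> + \<theta>B))) \<delta> wt \<and>
     qcomm (cis (- 2 * \<theta>B)) \<delta> zt \<and>
     qcomm (cis (2 * (\<theta> + \<theta>B))) z wt \<and>
     qcomm (cis (2 * \<theta>A)) z w \<and>
     qcomm (cis (2 * (\<theta> + \<theta>A + \<theta>B))) z zt \<and>
     qcomm (cis (2 * (\<theta>A - \<theta>B))) wt w \<and>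
     qcomm (cis (2 * (\<theta> + \<theta>A))) wt zt \<and>
     qcomm (cis (2 * \<theta>B)) w zt)"

definition trivial_relations :: "(gen \<Rightarrow> 'a) \<Rightarrow> bool" where
  "trivial_relations g \<longleftrightarrow>
     (\<forall>x\<in>{Ga, Galpha3, Gdelta3}. (g x)\<^sup>\<star> = g x) \<and>
     (\<forall>x\<in>{Ga, Galpha3, Gdelta3}. \<forall>y. g x \<odot> g y = g y \<odot> g x) \<and>
     (\<forall>x. g x \<odot> (g x)\<^sup>\<star> = (g x)\<^sup>\<star> \<odot> g x)"

text \<open>
  In the formula for \<open>(1 - 2a)\<delta>\<close> the factors of the last product stand in the order \<open>w\<^sup>\<star>, zt\<close> of
  the matrix product \<open>B\<^sup>\<dagger>B\<close>.  The opposite order \<open>zt, w\<^sup>\<star>\<close> differs from it by the phase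
  \<open>e\<^bsup>2i\<theta>\<^sub>B\<^esup>\<close>, so that the formula would hold classically but fail for the twisted product.
\<close>

definition projector_relations :: "(gen \<Rightarrow> 'a) \<Rightarrow> bool" where
  "projector_relations g \<longleftrightarrow>
    (let a = g Ga; \<alpha>3 = g Galpha3; \<delta>3 = g Gdelta3; \<alpha> = g Galpha; \<delta> = g Gdelta;
         z = g Gz; w = g Gw; zt = g Gzt; wt = g Gwt in
     z \<odot> z\<^sup>\<star> + w \<odot> w\<^sup>\<star> + zt \<odot> zt\<^sup>\<star> + wt \<odot> wt\<^sup>\<star>
       = 2 *s (a \<odot> (\<one> - a) - \<alpha> \<odot> \<alpha>\<^sup>\<star> - \<alpha>3 \<odot> \<alpha>3) \<and>
     (\<one> - 2 *s a) \<odot> \<alpha> = z \<odot> w\<^sup>\<star> + wt \<odot> zt\<^sup>\<star> \<and>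
     (\<one> - 2 *s a) \<odot> \<delta> = - (z\<^sup>\<star> \<odot> wt) - w\<^sup>\<star> \<odot> zt \<and>
     (\<one> - 2 *s a) \<odot> (\<alpha>3 + \<delta>3) = wt \<odot> wt\<^sup>\<star> - w \<odot> w\<^sup>\<star> \<and>
     (\<one> - 2 *s a) \<odot> (\<alpha>3 - \<delta>3) = z \<odot> z\<^sup>\<star> - zt \<odot> zt\<^sup>\<star> \<and>
     \<alpha> \<odot> \<alpha>\<^sup>\<star> + \<alpha>3 \<odot> \<alpha>3 = \<delta> \<odot> \<delta>\<^sup>\<star> + \<delta>3 \<odot> \<delta>3)"

text \<open>
  These are the entries of the off-diagonal block \<open>AB + BD = B\<close>, with \<open>\<delta>\<close> commuted to the left of
  the entries of B; the matrices of coefficients acting on \<open>(w, wt)\<close> and \<open>(z, zt)\<close> are multiplied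
  out.  With the opposite overall sign on the right of the last two equations they would already
  fail in the commutative algebra.
\<close>

definition matrix_relations :: "real^4^4 \<Rightarrow> (gen \<Rightarrow> 'a) \<Rightarrow> bool" where
  "matrix_relations \<theta>M g \<longleftrightarrow>
    (let \<alpha>3 = g Galpha3; \<delta>3 = g Gdelta3; \<alpha> = g Galpha; \<delta> = g Gdelta;
         z = g Gz; w = g Gw; zt = g Gzt; wt = g Gwt;
         \<theta> = theta_0 \<theta>M; \<theta>B = theta_B \<theta>M in
     (\<alpha>3 + \<delta>3) \<odot> z = - (\<alpha> \<odot> w) - cis (- 2 * (\<theta> + \<theta>B)) *s (\<delta>\<^sup>\<star> \<odot> wt) \<and>
     (\<alpha>3 + \<delta>3) \<odot> zt = cis (2 * \<theta>B) *s (\<delta> \<odot> w) + \<alpha>\<^sup>\<star> \<odot> wt \<and>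
     (\<alpha>3 - \<delta>3) \<odot> w = \<alpha>\<^sup>\<star> \<odot> z + cis (- 2 * \<theta>B) *s (\<delta>\<^sup>\<star> \<odot> zt) \<and>
     (\<alpha>3 - \<delta>3) \<odot> wt = - (cis (2 * (\<theta> + \<theta>B)) *s (\<delta> \<odot> z)) - \<alpha> \<odot> zt)"

text \<open>For \<open>\<theta>M = 0\<close> all phases are 1: these are then the relations of the classical algebra.\<close>

definition cm_relations :: "real^4^4 \<Rightarrow> (gen \<Rightarrow> 'a) \<Rightarrow> bool" where
  "cm_relations \<theta>M g \<longleftrightarrow>
     trivial_relations g \<and> commutation_relations \<theta>M g \<and>
     projector_relations g \<and> matrix_relations \<theta>M g"

end

definition star_algebra_hom ::
  "(complex \<Rightarrow> 'a::ab_group_add \<Rightarrow> 'a) \<Rightarrow> ('a \<Rightarrow> 'a \<Rightarrow> 'a) \<Rightarrow> 'a \<Rightarrow> ('a \<Rightarrow> 'a) \<Rightarrow>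
   (complex \<Rightarrow> 'b::ab_group_add \<Rightarrow> 'b) \<Rightarrow> ('b \<Rightarrow> 'b \<Rightarrow> 'b) \<Rightarrow> 'b \<Rightarrow> ('b \<Rightarrow> 'b) \<Rightarrow>
   ('a \<Rightarrow> 'b) \<Rightarrow> bool" where
  "star_algebra_hom sc mul one star sc' mul' one' star' \<phi> \<longleftrightarrow>
     Vector_Spaces.linear sc sc' \<phi> \<and>
     (\<forall>x y. \<phi> (mul x y) = mul' (\<phi> x) (\<phi> y)) \<and> \<phi> one = one' \<and> (\<forall>x. \<phi> (star x) = star' (\<phi> x))"

end

theory Submission
  imports Defs
begin

text \<open>
  The phases are chosen so that \<open>P\<close>-hat with the twisted product is again a self-adjoint projector of
  trace two, whose entries commute up to the phases \<open>F\<^sup>2\<close>.  In any *-algebra the listed relations for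
  the generators are equivalent to these properties of the block matrix.  Conversely, such a matrix
  \<open>Q\<close> determines a homomorphism: sending a monomial to the ordered product of the entries of \<open>Q\<close>,
  corrected by the phase that untwists the product, does not depend on the order of the factors, and
  the linear extension kills the ideal of relations because that ideal is homogeneous.  The classical
  algebra is the case \<open>\<theta> = 0\<close>.
\<close>

text \<open>Calling a list "the relations" of an algebra claims completeness, and this is expressed
  as a universal property among all *-algebras. An implication from the projector to the list does
  not suffice for that: the converse, in an arbitrary *-algebra, must turn a solution of the listed
  relations into a matrix \<open>Q\<close>. Hence the equivalence is proved abstractly; one
  direction is applied to P-hat, the other to the target of a homomorphism. The obstacle is that the
  twisted algebra arises from commutative polynomials modulo an ideal for the ordinary product,
  while a map to the target can respect only the twisted one. Evaluation at \<open>Q\<close> is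
  therefore no substitution of variables: a monomial carries no order of its factors, yet the
  entries of \<open>Q\<close> do not commute. What helps is that \<open>F\<close> is a bicharacter
  of modulus one whose value is inverted when its arguments are exchanged. Reordering two factors
  costs \<open>F\<close> squared, and the two possible orders can share this cost evenly, each
  absorbing one factor \<open>F\<close>.\<close>

lemma vector_4 [simp]:
  "(vector [w, x, y, z] :: 'a::zero^4) $ 1 = w"
  "(vector [w, x, y, z] :: 'a::zero^4) $ 2 = x"
  "(vector [w, x, y, z] :: 'a::zero^4) $ 3 = y"
  "(vector [w, x, y, z] :: 'a::zero^4) $ 4 = z"
  unfolding vector_def by simp_all

section \<open>The bicharacter \<open>F\<close> on exponent vectors\<close>

lemma F_add_left: "F \<theta> (a + b) c = F \<theta> a c * F \<theta> b c"
  by (simp add: F_def cis_mult sum.distrib algebra_simps)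

lemma F_add_right: "F \<theta> a (b + c) = F \<theta> a b * F \<theta> a c"
  by (simp add: F_def cis_mult sum.distrib algebra_simps)

lemma F_zero_left [simp]: "F \<theta> 0 b = 1"
  by (simp add: F_def)

lemma F_zero_right [simp]: "F \<theta> a 0 = 1"
  by (simp add: F_def)

lemma F_uminus_left: "F \<theta> (- a) b = cnj (F \<theta> a b)"
  by (simp add: F_def cis_cnj sum_negf)

lemma F_uminus_right: "F \<theta> a (- b) = cnj (F \<theta> a b)"
  by (simp add: F_def cis_cnj sum_negf)

lemma F_cnj_mult [simp]: "cnj (F \<theta> a b) * F \<theta> a b = 1" "F \<theta> a b * cnj (F \<theta> a b) = 1"
  by (simp_all add: F_def cis_cnj cis_mult)

lemma F_nonzero [simp]: "F \<theta> a b \<noteq> 0"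
  by (simp add: F_def)

lemma transpose_uminus_nth:
  assumes "transpose \<theta> = - \<theta>"
  shows "\<theta> $ j $ i = - \<theta> $ i $ j"
proof -
  have "\<theta> $ j $ i = transpose \<theta> $ i $ j" by (simp add: transpose_def)
  then show ?thesis by (simp add: assms)
qed

lemma antisymmetric_bilinear_swap:
  assumes "transpose \<theta> = - \<theta>"
  shows "(\<Sum>\<mu>\<in>UNIV. \<Sum>\<nu>\<in>UNIV. of_int (b $ \<mu>) * \<theta> $ \<mu> $ \<nu> * of_int (a $ \<nu>))
    = - (\<Sum>\<mu>\<in>UNIV. \<Sum>\<nu>\<in>UNIV. of_int (a $ \<mu>) * (\<theta> $ \<mu> $ \<nu> :: real) * of_int (b $ \<nu>))"
proof -
  have "of_int (b $ \<mu>) * \<theta> $ \<mu> $ \<nu> * of_int (a $ \<nu>)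
      = - (of_int (a $ \<nu>) * \<theta> $ \<nu> $ \<mu> * of_int (b $ \<mu>))" for \<mu> \<nu>
    unfolding transpose_uminus_nth[OF assms, of \<nu> \<mu>] by simp
  then have "(\<Sum>\<mu>\<in>UNIV. \<Sum>\<nu>\<in>UNIV. of_int (b $ \<mu>) * \<theta> $ \<mu> $ \<nu> * of_int (a $ \<nu>))
      = - (\<Sum>\<mu>\<in>UNIV. \<Sum>\<nu>\<in>UNIV. of_int (a $ \<nu>) * \<theta> $ \<nu> $ \<mu> * of_int (b $ \<mu>))"
    by (simp only: sum_negf)
  also have "(\<Sum>\<mu>\<in>UNIV. \<Sum>\<nu>\<in>UNIV. of_int (a $ \<nu>) * \<theta> $ \<nu> $ \<mu> * of_int (b $ \<mu>))
      = (\<Sum>\<nu>\<in>UNIV. \<Sum>\<mu>\<in>UNIV. of_int (a $ \<nu>) * \<theta> $ \<nu> $ \<mu> * of_int (b $ \<mu>))"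
    by (rule sum.swap)
  finally show ?thesis .
qed

text \<open>As \<open>F\<close> has modulus one, the quotient of \<open>F \<theta> a b\<close> by
  \<open>F \<theta> b a\<close> is the square of \<open>F \<theta> a b\<close>. This is the origin
  of the factor 2 in all exponents of the commutation relations.\<close>

lemma F_swap: "transpose \<theta> = - \<theta> \<Longrightarrow> F \<theta> b a = cnj (F \<theta> a b)"
  using antisymmetric_bilinear_swap[of \<theta> b a] by (simp add: F_def cis_cnj)

lemma F_self: "transpose \<theta> = - \<theta> \<Longrightarrow> F \<theta> a a = 1"
  using antisymmetric_bilinear_swap[of \<theta> a a] by (simp add: F_def)

definition entry_wt :: "4 \<Rightarrow> 4 \<Rightarrow> int^4" where
  "entry_wt \<mu> \<nu> = axis \<mu> 1 - axis \<nu> 1"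

lemma entry_wt_swap: "entry_wt \<nu> \<mu> = - entry_wt \<mu> \<nu>"
  by (simp add: entry_wt_def)

text \<open>A weight of a matrix entry is a difference of unit vectors, so the bilinear form
  collapses to four entries of \<theta>. The angles \<open>theta_0\<close>, \<open>theta_A\<close>
  and \<open>theta_B\<close> are such combinations, simplified by antisymmetry.\<close>

lemma F_entry_wt:
  "F \<theta> (entry_wt \<mu> \<nu>) (entry_wt \<rho> \<sigma>)
    = cis (\<theta> $ \<mu> $ \<rho> - \<theta> $ \<mu> $ \<sigma> - \<theta> $ \<nu> $ \<rho> + \<theta> $ \<nu> $ \<sigma>)"
proof -
  have 1: "(\<Sum>\<kappa>\<in>UNIV. of_int (entry_wt i j $ \<kappa>) * f \<kappa>) = f i - f j" for i j and f :: "4 \<Rightarrow> real"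
  proof -
    have "(\<Sum>\<kappa>\<in>UNIV. of_int (entry_wt i j $ \<kappa>) * f \<kappa>)
        = (\<Sum>\<kappa>\<in>UNIV. (if \<kappa> = i then f \<kappa> else 0) - (if \<kappa> = j then f \<kappa> else 0))"
      by (rule sum.cong) (auto simp: entry_wt_def axis_def)
    then show ?thesis by (simp add: sum_subtractf)
  qed
  have "(\<Sum>\<kappa>\<in>UNIV. \<Sum>\<tau>\<in>UNIV. of_int (entry_wt \<mu> \<nu> $ \<kappa>) * \<theta> $ \<kappa> $ \<tau> * of_int (entry_wt \<rho> \<sigma> $ \<tau>))
      = (\<Sum>\<kappa>\<in>UNIV. of_int (entry_wt \<mu> \<nu> $ \<kappa>) * (\<Sum>\<tau>\<in>UNIV. of_int (entry_wt \<rho> \<sigma> $ \<tau>) * \<theta> $ \<kappa> $ \<tau>))"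
    by (simp add: sum_distrib_left mult_ac)
  also have "\<dots> = \<theta> $ \<mu> $ \<rho> - \<theta> $ \<mu> $ \<sigma> - \<theta> $ \<nu> $ \<rho> + \<theta> $ \<nu> $ \<sigma>"
    unfolding 1 by simp
  finally show ?thesis by (simp add: F_def)
qed

lemma F_entry_wt_diag [simp]: "F \<theta> (entry_wt \<mu> \<mu>) b = 1" "F \<theta> b (entry_wt \<mu> \<mu>) = 1"
  by (simp_all add: entry_wt_def)

section \<open>Relations in a *-algebra\<close>

context star_algebra
begin

lemma mult_zero_left: "0 \<odot> x = 0"
  using distrib_right'[of 0 0 x] by simp

lemma mult_zero_right: "x \<odot> 0 = 0"
  using distrib_left'[of x 0 0] by simp

lemma mult_diff_right: "(x - y) \<odot> z = x \<odot> z - y \<odot> z"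
  using distrib_right'[of "x - y" y z] by simp

lemma mult_diff_left: "z \<odot> (x - y) = z \<odot> x - z \<odot> y"
  using distrib_left'[of z "x - y" y] by simp

lemma mult_uminus_right: "(- x) \<odot> z = - (x \<odot> z)"
  using mult_diff_right[of 0 x z] by (simp add: mult_zero_left)

lemma mult_uminus_left: "z \<odot> (- x) = - (z \<odot> x)"
  using mult_diff_left[of z 0 x] by (simp add: mult_zero_right)

lemmas mult_linear_simps = distrib_left' distrib_right' mult_diff_left mult_diff_right
  mult_uminus_left mult_uminus_right mult_zero_left mult_zero_right one_left one_right

lemma star_zero [simp]: "0\<^sup>\<star> = 0"
  using star_add[of 0 0] by simp

lemma star_diff: "(x - y)\<^sup>\<star> = x\<^sup>\<star> - y\<^sup>\<star>"
  using star_add[of "x - y" y] by simp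

lemma star_one [simp]: "\<one>\<^sup>\<star> = \<one>"
  by (metis one_left one_right star_mult star_star)

lemma star_sum: "(sum f A)\<^sup>\<star> = (\<Sum>x\<in>A. (f x)\<^sup>\<star>)"
  by (induction A rule: infinite_finite_induct) (simp_all add: star_add)

lemma scale_two: "scale 2 (x :: 'a) = x + x"
  using scale_left_distrib[of 1 1 x] by simp

lemma double_eq_iff: "(x :: 'a) + x = y + y \<longleftrightarrow> x = y"
  using scale_cancel_left[of 2 x y] by (simp add: scale_two)

text \<open>The block form \<open>gen_matrix\<close> with an arbitrary *-algebra in place of
  \<open>cm\<close>, so that it can be formed both for the coordinate algebra and for the target of
  a homomorphism.\<close>

definition proj_entry :: "(gen \<Rightarrow> 'a) \<Rightarrow> 4 \<Rightarrow> 4 \<Rightarrow> 'a" where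
  "proj_entry g \<mu> \<nu> = (vector [
     vector [g Ga + g Galpha3,   g Galpha,            g Gz,                      g Gwt],
     vector [(g Galpha)\<^sup>\<star>, g Ga - g Galpha3,    g Gw,                      g Gzt],
     vector [(g Gz)\<^sup>\<star>,     (g Gw)\<^sup>\<star>,      \<one> - g Ga + g Gdelta3,      g Gdelta],
     vector [(g Gwt)\<^sup>\<star>,    (g Gzt)\<^sup>\<star>,     (g Gdelta)\<^sup>\<star>,        \<one> - g Ga - g Gdelta3]]
     :: 'a^4^4) $ \<mu> $ \<nu>"

lemma proj_entry_simps:
  "proj_entry g 1 1 = g Ga + g Galpha3" "proj_entry g 1 2 = g Galpha"
  "proj_entry g 1 3 = g Gz" "proj_entry g 1 4 = g Gwt"
  "proj_entry g 2 1 = (g Galpha)\<^sup>\<star>" "proj_entry g 2 2 = g Ga - g Galpha3"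
  "proj_entry g 2 3 = g Gw" "proj_entry g 2 4 = g Gzt"
  "proj_entry g 3 1 = (g Gz)\<^sup>\<star>" "proj_entry g 3 2 = (g Gw)\<^sup>\<star>"
  "proj_entry g 3 3 = \<one> - g Ga + g Gdelta3" "proj_entry g 3 4 = g Gdelta"
  "proj_entry g 4 1 = (g Gwt)\<^sup>\<star>" "proj_entry g 4 2 = (g Gzt)\<^sup>\<star>"
  "proj_entry g 4 3 = (g Gdelta)\<^sup>\<star>" "proj_entry g 4 4 = \<one> - g Ga - g Gdelta3"
  by (simp_all add: proj_entry_def)

end

text \<open>The matrix form of the relations. \<open>Q_commute\<close> contains the trivial ones as
  well: a diagonal entry has weight zero and so commutes with every entry, while an entry and its
  star have opposite weights, on which \<open>F\<close> is 1.\<close>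

locale twisted_projector = star_algebra +
  fixes \<theta> :: "real^4^4" and Q :: "4 \<Rightarrow> 4 \<Rightarrow> 'a"
  assumes antisym: "transpose \<theta> = - \<theta>"
    and star_Q: "(Q \<mu> \<nu>)\<^sup>\<star> = Q \<nu> \<mu>"
    and Q_commute: "Q \<mu> \<nu> \<odot> Q \<rho> \<sigma>
      = (F \<theta> (entry_wt \<mu> \<nu>) (entry_wt \<rho> \<sigma>))\<^sup>2 *s (Q \<rho> \<sigma> \<odot> Q \<mu> \<nu>)"
    and Q_proj: "(\<Sum>\<nu>\<in>UNIV. Q \<mu> \<nu> \<odot> Q \<nu> \<rho>) = Q \<mu> \<rho>"
    and Q_trace: "(\<Sum>\<mu>\<in>UNIV. Q \<mu> \<mu>) = 2 *s \<one>"
begin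

lemma Q_diag_central: "Q \<mu> \<mu> \<odot> Q \<rho> \<sigma> = Q \<rho> \<sigma> \<odot> Q \<mu> \<mu>"
  using Q_commute[of \<mu> \<mu> \<rho> \<sigma>] by simp

text \<open>Taking the star of one entry negates its weight and thereby conjugates the phase; this
  explains the "inverse coefficient" in \<open>qcomm\<close>.\<close>

lemma Q_qcomm:
  assumes "c = (F \<theta> (entry_wt \<mu> \<nu>) (entry_wt \<rho> \<sigma>))\<^sup>2"
  shows "qcomm c (Q \<mu> \<nu>) (Q \<rho> \<sigma>)"
  unfolding qcomm_def star_Q assms
  using Q_commute[of \<mu> \<nu> \<rho> \<sigma>] Q_commute[of \<mu> \<nu> \<sigma> \<rho>] Q_commute[of \<nu> \<mu> \<rho> \<sigma>]
  by (simp add: entry_wt_swap[of \<nu> \<mu>] entry_wt_swap[of \<sigma> \<rho>] F_uminus_left F_uminus_right)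

end

section \<open>Relations for the generators versus properties of the block matrix\<close>

context star_algebra
begin

text \<open>The diagonal entries are a plus or minus \<alpha>3 and 1 - a plus or minus \<delta>3. A
  property linear in the entries is transferred to a by adding the first two and cancelling the
  factor 2, and then to \<alpha>3 and \<delta>3 by subtraction.\<close>

lemma selfadjoint_relations:
  assumes "twisted_projector scale (\<odot>) \<one> star \<theta> (proj_entry g)"
  shows "trivial_relations g"
proof -
  interpret Q: twisted_projector scale "(\<odot>)" \<one> star \<theta> "proj_entry g" by fact
  note star = Q.star_Q[of 1 1] Q.star_Q[of 2 2] Q.star_Q[of 3 3] Q.star_Q[of 4 4]
  note star = star[unfolded proj_entry_simps star_add star_diff star_one]
  have "(g Ga)\<^sup>\<star> + (g Ga)\<^sup>\<star> = g Ga + g Ga"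
    using arg_cong2[OF star(1,2), of "(+)"] by (simp add: algebra_simps)
  then have a: "(g Ga)\<^sup>\<star> = g Ga" by (simp add: double_eq_iff)
  then have sa: "(g x)\<^sup>\<star> = g x" if "x \<in> {Ga, Galpha3, Gdelta3}" for x
    using star that by auto
  have a_Q: "g Ga \<odot> proj_entry g \<mu> \<nu> = proj_entry g \<mu> \<nu> \<odot> g Ga" for \<mu> \<nu>
  proof -
    have "(g Ga + g Ga) \<odot> proj_entry g \<mu> \<nu> = proj_entry g \<mu> \<nu> \<odot> (g Ga + g Ga)"
      using arg_cong2[OF Q.Q_diag_central[of 1 \<mu> \<nu>] Q.Q_diag_central[of 2 \<mu> \<nu>], of "(+)"]
      by (simp add: proj_entry_simps(1,6) mult_linear_simps algebra_simps)
    then show ?thesis by (simp add: double_eq_iff mult_linear_simps)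
  qed
  have central: "g x \<odot> proj_entry g \<mu> \<nu> = proj_entry g \<mu> \<nu> \<odot> g x"
    if "x \<in> {Ga, Galpha3, Gdelta3}" for x \<mu> \<nu>
    using that Q.Q_diag_central[of 1 \<mu> \<nu>] Q.Q_diag_central[of 3 \<mu> \<nu>] a_Q[of \<mu> \<nu>]
    by (auto simp: proj_entry_simps(1,11) mult_linear_simps)
  have comm: "g x \<odot> g y = g y \<odot> g x" if x: "x \<in> {Ga, Galpha3, Gdelta3}" for x y
  proof -
    \<comment> \<open>Commutation with the matrix entries has to be turned into commutation with the
      generators, so the diagonal is solved for a once more.\<close>
    note C = central[OF x, of 1 1] central[OF x, of 2 2]
    have "g x \<odot> (g Ga + g Ga) = (g Ga + g Ga) \<odot> g x"
      using arg_cong2[OF C, of "(+)"]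
      by (simp add: proj_entry_simps mult_linear_simps algebra_simps)
    then have a: "g x \<odot> g Ga = g Ga \<odot> g x" by (simp add: double_eq_iff mult_linear_simps)
    show ?thesis
      using a C central[OF x, of 3 3] central[OF x, of 1 2] central[OF x, of 1 3]
        central[OF x, of 1 4] central[OF x, of 2 3] central[OF x, of 2 4] central[OF x, of 3 4]
      by (cases y) (simp_all add: proj_entry_simps mult_linear_simps)
  qed
  have norm: "proj_entry g \<mu> \<nu> \<odot> (proj_entry g \<mu> \<nu>)\<^sup>\<star> = (proj_entry g \<mu> \<nu>)\<^sup>\<star> \<odot> proj_entry g \<mu> \<nu>" for \<mu> \<nu>
    using Q.Q_commute[of \<mu> \<nu> \<nu> \<mu>]
    by (simp add: Q.star_Q entry_wt_swap[of \<nu> \<mu>] F_uminus_right F_self[OF Q.antisym])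
  have "g x \<odot> (g x)\<^sup>\<star> = (g x)\<^sup>\<star> \<odot> g x" for x
    using norm[of 1 2] norm[of 1 3] norm[of 1 4] norm[of 2 3] norm[of 2 4] norm[of 3 4] sa
    by (cases x) (simp_all add: proj_entry_simps)
  then show ?thesis
    using sa comm by (simp add: trivial_relations_def)
qed

lemma commutation_relations_proj_entry:
  assumes "twisted_projector scale (\<odot>) \<one> star \<theta> (proj_entry g)"
  shows "commutation_relations \<theta> g"
proof -
  interpret Q: twisted_projector scale "(\<odot>)" \<one> star \<theta> "proj_entry g" by fact
  have diag: "\<theta> $ i $ i = 0" for i
    using transpose_uminus_nth[OF Q.antisym, of i i] by simp
  note anti = transpose_uminus_nth[OF Q.antisym, of 2 1] transpose_uminus_nth[OF Q.antisym, of 3 1]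
    transpose_uminus_nth[OF Q.antisym, of 4 1] transpose_uminus_nth[OF Q.antisym, of 3 2]
    transpose_uminus_nth[OF Q.antisym, of 4 2] transpose_uminus_nth[OF Q.antisym, of 4 3]
  have *: "qcomm (cis c) (proj_entry g \<mu> \<nu>) (proj_entry g \<rho> \<sigma>)"
    if "c = 2 * (\<theta> $ \<mu> $ \<rho> - \<theta> $ \<mu> $ \<sigma> - \<theta> $ \<nu> $ \<rho> + \<theta> $ \<nu> $ \<sigma>)" for c \<mu> \<nu> \<rho> \<sigma>
    by (rule Q.Q_qcomm) (simp only: that F_entry_wt power2_eq_square cis_mult mult_2)
  \<comment> \<open>The fifteen unordered pairs of the six entries above the diagonal, each oriented
    as in the list of relations.\<close>
  note q = *[where \<mu>=1 and \<nu>=2 and \<rho>=3 and \<sigma>=4, unfolded proj_entry_simps]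
    *[where \<mu>=1 and \<nu>=2 and \<rho>=1 and \<sigma>=3, unfolded proj_entry_simps]
    *[where \<mu>=1 and \<nu>=2 and \<rho>=1 and \<sigma>=4, unfolded proj_entry_simps]
    *[where \<mu>=1 and \<nu>=2 and \<rho>=2 and \<sigma>=3, unfolded proj_entry_simps]
    *[where \<mu>=1 and \<nu>=2 and \<rho>=2 and \<sigma>=4, unfolded proj_entry_simps]
    *[where \<mu>=3 and \<nu>=4 and \<rho>=1 and \<sigma>=3, unfolded proj_entry_simps]
    *[where \<mu>=3 and \<nu>=4 and \<rho>=2 and \<sigma>=3, unfolded proj_entry_simps]
    *[where \<mu>=3 and \<nu>=4 and \<rho>=1 and \<sigma>=4, unfolded proj_entry_simps]
    *[where \<mu>=3 and \<nu>=4 and \<rho>=2 and \<sigma>=4, unfolded proj_entry_simps]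
    *[where \<mu>=1 and \<nu>=3 and \<rho>=1 and \<sigma>=4, unfolded proj_entry_simps]
    *[where \<mu>=1 and \<nu>=3 and \<rho>=2 and \<sigma>=3, unfolded proj_entry_simps]
    *[where \<mu>=1 and \<nu>=3 and \<rho>=2 and \<sigma>=4, unfolded proj_entry_simps]
    *[where \<mu>=1 and \<nu>=4 and \<rho>=2 and \<sigma>=3, unfolded proj_entry_simps]
    *[where \<mu>=1 and \<nu>=4 and \<rho>=2 and \<sigma>=4, unfolded proj_entry_simps]
    *[where \<mu>=2 and \<nu>=3 and \<rho>=2 and \<sigma>=4, unfolded proj_entry_simps]
  show ?thesis
    unfolding commutation_relations_def Let_def theta_0_def theta_A_def theta_B_def
    by (intro conjI; rule q; simp add: diag anti)
qed

text \<open>Compare the defect \<open>E\<close> of idempotency with the defects \<open>D1\<close> to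
  \<open>D6\<close>, \<open>M1\<close> to \<open>M4\<close> of the listed relations. Since
  \<open>E\<close> is self-adjoint, the diagonal and the upper triangle suffice. The off-diagonal
  entries are single defects. On the diagonal, the sum and difference within each block are
  combinations of \<open>D1\<close>, \<open>D4\<close>, \<open>D5\<close>, \<open>D6\<close>, and
  this linear system is invertible because 2 is.\<close>

lemma proj_entry_idempotent_iff:
  assumes "trivial_relations g" "commutation_relations \<theta> g"
  shows "(\<forall>\<mu> \<rho>. (\<Sum>\<nu>\<in>UNIV. proj_entry g \<mu> \<nu> \<odot> proj_entry g \<nu> \<rho>) = proj_entry g \<mu> \<rho>)
    \<longleftrightarrow> projector_relations g \<and> matrix_relations \<theta> g"
proof -
  define a \<alpha>3 \<delta>3 \<alpha> \<delta> z w zt wt where gens_def: "a = g Ga" "\<alpha>3 = g Galpha3" "\<delta>3 = g Gdelta3"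
    "\<alpha> = g Galpha" "\<delta> = g Gdelta" "z = g Gz" "w = g Gw" "zt = g Gzt" "wt = g Gwt"
  have sa: "a\<^sup>\<star> = a" "\<alpha>3\<^sup>\<star> = \<alpha>3" "\<delta>3\<^sup>\<star> = \<delta>3"
    and a: "\<And>x. g x \<odot> a = a \<odot> g x" and \<alpha>3: "\<And>x. g x \<odot> \<alpha>3 = \<alpha>3 \<odot> g x"
    and \<delta>3: "\<And>x. g x \<odot> \<delta>3 = \<delta>3 \<odot> g x"
    and normal: "\<And>x. (g x)\<^sup>\<star> \<odot> g x = g x \<odot> (g x)\<^sup>\<star>"
    using assms(1) unfolding trivial_relations_def gens_def by simp_all
  \<comment> \<open>Oriented as rewrite rules towards a normal form: a, \<alpha>3, \<delta>3 move to
    the left in this order, and a star moves to the right of its own generator.\<close>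
  have comm: "\<alpha>3 \<odot> a = a \<odot> \<alpha>3" "\<delta>3 \<odot> a = a \<odot> \<delta>3" "\<delta>3 \<odot> \<alpha>3 = \<alpha>3 \<odot> \<delta>3"
    "\<alpha> \<odot> a = a \<odot> \<alpha>" "\<delta> \<odot> a = a \<odot> \<delta>" "z \<odot> a = a \<odot> z" "w \<odot> a = a \<odot> w" "zt \<odot> a = a \<odot> zt" "wt \<odot> a = a \<odot> wt"
    "\<alpha> \<odot> \<alpha>3 = \<alpha>3 \<odot> \<alpha>" "\<delta> \<odot> \<alpha>3 = \<alpha>3 \<odot> \<delta>" "z \<odot> \<alpha>3 = \<alpha>3 \<odot> z" "w \<odot> \<alpha>3 = \<alpha>3 \<odot> w" "zt \<odot> \<alpha>3 = \<alpha>3 \<odot> zt" "wt \<odot> \<alpha>3 = \<alpha>3 \<odot> wt"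
    "\<alpha> \<odot> \<delta>3 = \<delta>3 \<odot> \<alpha>" "\<delta> \<odot> \<delta>3 = \<delta>3 \<odot> \<delta>" "z \<odot> \<delta>3 = \<delta>3 \<odot> z" "w \<odot> \<delta>3 = \<delta>3 \<odot> w" "zt \<odot> \<delta>3 = \<delta>3 \<odot> zt" "wt \<odot> \<delta>3 = \<delta>3 \<odot> wt"
    "\<alpha>\<^sup>\<star> \<odot> \<alpha> = \<alpha> \<odot> \<alpha>\<^sup>\<star>" "\<delta>\<^sup>\<star> \<odot> \<delta> = \<delta> \<odot> \<delta>\<^sup>\<star>" "z\<^sup>\<star> \<odot> z = z \<odot> z\<^sup>\<star>" "w\<^sup>\<star> \<odot> w = w \<odot> w\<^sup>\<star>"
    "zt\<^sup>\<star> \<odot> zt = zt \<odot> zt\<^sup>\<star>" "wt\<^sup>\<star> \<odot> wt = wt \<odot> wt\<^sup>\<star>"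
    unfolding gens_def using a \<alpha>3 \<delta>3 normal unfolding gens_def by blast+
  let ?\<theta> = "theta_0 \<theta>" and ?B = "theta_B \<theta>"
  have "qcomm (cis (- 2 * (?\<theta> + ?B))) \<delta> z" "qcomm (cis (- 2 * ?B)) \<delta> w"
    "qcomm (cis (- 2 * (?\<theta> + ?B))) \<delta> wt" "qcomm (cis (- 2 * ?B)) \<delta> zt"
    using assms(2) unfolding commutation_relations_def Let_def gens_def by blast+
  \<comment> \<open>In the product BD the entries of D stand to the right of those of B, whereas the
    matrix relations have \<delta> on the left. Moving it across is the only source of phases
    there.\<close>
  then have \<delta>: "wt \<odot> \<delta>\<^sup>\<star> = cis (- 2 * (?\<theta> + ?B)) *s (\<delta>\<^sup>\<star> \<odot> wt)"
      "w \<odot> \<delta> = cis (2 * ?B) *s (\<delta> \<odot> w)"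
      "zt \<odot> \<delta>\<^sup>\<star> = cis (- 2 * ?B) *s (\<delta>\<^sup>\<star> \<odot> zt)"
      "z \<odot> \<delta> = cis (2 * (?\<theta> + ?B)) *s (\<delta> \<odot> z)"
    unfolding qcomm_def by (simp_all add: cis_cnj cis_mult)
  define E where "E \<mu> \<rho> = (\<Sum>\<nu>\<in>UNIV. proj_entry g \<mu> \<nu> \<odot> proj_entry g \<nu> \<rho>) - proj_entry g \<mu> \<rho>" for \<mu> \<rho>
  have star_entry: "(proj_entry g \<mu> \<nu>)\<^sup>\<star> = proj_entry g \<nu> \<mu>" for \<mu> \<nu>
    using exhaust_4[of \<mu>] exhaust_4[of \<nu>] sa unfolding gens_def
    by (auto simp: proj_entry_simps star_add star_diff star_star)
  have E_star: "(E \<mu> \<rho>)\<^sup>\<star> = E \<rho> \<mu>" for \<mu> \<rho>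
    by (simp add: E_def star_diff star_sum star_mult star_entry)
  \<comment> \<open>The signs of the defects are chosen such that the off-diagonal ones become
    entries of \<open>E\<close> exactly.\<close>
  define D1 where "D1 = z \<odot> z\<^sup>\<star> + w \<odot> w\<^sup>\<star> + zt \<odot> zt\<^sup>\<star> + wt \<odot> wt\<^sup>\<star>
    - 2 *s (a \<odot> (\<one> - a) - \<alpha> \<odot> \<alpha>\<^sup>\<star> - \<alpha>3 \<odot> \<alpha>3)"
  define D2 where "D2 = z \<odot> w\<^sup>\<star> + wt \<odot> zt\<^sup>\<star> - (\<one> - 2 *s a) \<odot> \<alpha>"
  define D3 where "D3 = (\<one> - 2 *s a) \<odot> \<delta> - (- (z\<^sup>\<star> \<odot> wt) - w\<^sup>\<star> \<odot> zt)"
  define D4 where "D4 = wt \<odot> wt\<^sup>\<star> - w \<odot> w\<^sup>\<star> - (\<one> - 2 *s a) \<odot> (\<alpha>3 + \<delta>3)"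
  define D5 where "D5 = z \<odot> z\<^sup>\<star> - zt \<odot> zt\<^sup>\<star> - (\<one> - 2 *s a) \<odot> (\<alpha>3 - \<delta>3)"
  define D6 where "D6 = \<alpha> \<odot> \<alpha>\<^sup>\<star> + \<alpha>3 \<odot> \<alpha>3 - (\<delta> \<odot> \<delta>\<^sup>\<star> + \<delta>3 \<odot> \<delta>3)"
  define M1 where "M1 = (\<alpha>3 + \<delta>3) \<odot> z - (- (\<alpha> \<odot> w) - cis (- 2 * (?\<theta> + ?B)) *s (\<delta>\<^sup>\<star> \<odot> wt))"
  define M2 where "M2 = cis (2 * ?B) *s (\<delta> \<odot> w) + \<alpha>\<^sup>\<star> \<odot> wt - (\<alpha>3 + \<delta>3) \<odot> zt"
  define M3 where "M3 = \<alpha>\<^sup>\<star> \<odot> z + cis (- 2 * ?B) *s (\<delta>\<^sup>\<star> \<odot> zt) - (\<alpha>3 - \<delta>3) \<odot> w"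
  define M4 where "M4 = (\<alpha>3 - \<delta>3) \<odot> wt - (- (cis (2 * (?\<theta> + ?B)) *s (\<delta> \<odot> z)) - \<alpha> \<odot> zt)"
  have diag: "E 1 1 + E 2 2 = D1" "E 1 1 - E 2 2 = D4 + D5"
    "E 3 3 - E 4 4 = D5 - D4" "E 3 3 + E 4 4 = D1 - (D6 + D6)"
    unfolding E_def sum_4 proj_entry_simps gens_def[symmetric] D1_def D4_def D5_def D6_def scale_two mult_linear_simps comm
    by (simp_all add: algebra_simps)
  have off_diag: "E 1 2 = D2" "E 3 4 = D3" "E 1 3 = M1" "E 2 4 = M2" "E 2 3 = M3" "E 1 4 = M4"
    unfolding E_def sum_4 proj_entry_simps gens_def[symmetric] D2_def D3_def M1_def M2_def M3_def M4_def scale_two mult_linear_simps comm \<delta>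
    by (simp_all add: algebra_simps)
  have "projector_relations g \<and> matrix_relations \<theta> g \<longleftrightarrow>
      D1 = 0 \<and> D2 = 0 \<and> D3 = 0 \<and> D4 = 0 \<and> D5 = 0 \<and> D6 = 0 \<and> M1 = 0 \<and> M2 = 0 \<and> M3 = 0 \<and> M4 = 0"
    unfolding projector_relations_def matrix_relations_def Let_def gens_def[symmetric]
      D1_def D2_def D3_def D4_def D5_def D6_def M1_def M2_def M3_def M4_def right_minus_eq
    by metis
  also have "\<dots> \<longleftrightarrow> E 1 1 = 0 \<and> E 2 2 = 0 \<and> E 3 3 = 0 \<and> E 4 4 = 0 \<and>
      E 1 2 = 0 \<and> E 3 4 = 0 \<and> E 1 3 = 0 \<and> E 2 4 = 0 \<and> E 2 3 = 0 \<and> E 1 4 = 0"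
  proof -
    have double: "x = 0" if "x + x = 0" for x :: 'a
      using that double_eq_iff[of x 0] by simp
    have split: "x = 0 \<and> y = 0" if "x + y = 0" "x - y = 0" for x y :: 'a
      using that double[of y] by simp
    have "E 1 1 = 0 \<and> E 2 2 = 0 \<and> E 3 3 = 0 \<and> E 4 4 = 0"
      if "D1 = 0" "D4 = 0" "D5 = 0" "D6 = 0"
      using split[of "E 1 1" "E 2 2"] split[of "E 3 3" "E 4 4"] diag that by simp
    moreover have "D6 + D6 = D1 - (E 3 3 + E 4 4)"
      unfolding diag by simp
    then have "D1 = 0 \<and> D4 = 0 \<and> D5 = 0 \<and> D6 = 0"
      if "E 1 1 = 0" "E 2 2 = 0" "E 3 3 = 0" "E 4 4 = 0"
      using split[of D5 D4] double[of D6] diag(1-3) that by (simp add: add.commute)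
    ultimately show ?thesis unfolding off_diag by blast
  qed
  also have "\<dots> \<longleftrightarrow> (\<forall>\<mu> \<rho>. E \<mu> \<rho> = 0)"
  proof -
    have "E \<mu> \<rho> = 0 \<Longrightarrow> E \<rho> \<mu> = 0" for \<mu> \<rho>
      using E_star[of \<mu> \<rho>] by simp
    then show ?thesis unfolding forall_4 by blast
  qed
  finally show ?thesis by (simp add: E_def)
qed

text \<open>The property \<open>C\<close> survives exchanging the two entries and transposing both
  of them, so every listed relation, with its conjugated versions, yields eight of the 256
  instances. The fifteen relations give 120; the six pairs of an entry with itself or its star give
  24, by normality; in the remaining 112 a diagonal entry occurs, and it is central.\<close>

lemma proj_entry_Q_commute:
  assumes "transpose \<theta> = - \<theta>" "trivial_relations g" "commutation_relations \<theta> g"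
  shows "proj_entry g \<mu> \<nu> \<odot> proj_entry g \<rho> \<sigma>
    = (F \<theta> (entry_wt \<mu> \<nu>) (entry_wt \<rho> \<sigma>))\<^sup>2 *s (proj_entry g \<rho> \<sigma> \<odot> proj_entry g \<mu> \<nu>)"
proof -
  define C where "C \<mu> \<nu> \<rho> \<sigma> \<longleftrightarrow> proj_entry g \<mu> \<nu> \<odot> proj_entry g \<rho> \<sigma>
    = (F \<theta> (entry_wt \<mu> \<nu>) (entry_wt \<rho> \<sigma>))\<^sup>2 *s (proj_entry g \<rho> \<sigma> \<odot> proj_entry g \<mu> \<nu>)" for \<mu> \<nu> \<rho> \<sigma>
  have sa: "(g x)\<^sup>\<star> = g x" and central: "g x \<odot> g y = g y \<odot> g x"
    if "x \<in> {Ga, Galpha3, Gdelta3}" for x y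
    using assms(2) that unfolding trivial_relations_def by blast+
  have normal: "g x \<odot> (g x)\<^sup>\<star> = (g x)\<^sup>\<star> \<odot> g x" for x
    using assms(2) unfolding trivial_relations_def by blast
  have star_entry: "(proj_entry g \<mu> \<nu>)\<^sup>\<star> = proj_entry g \<nu> \<mu>" for \<mu> \<nu>
    using exhaust_4[of \<mu>] exhaust_4[of \<nu>]
    by (auto simp: proj_entry_simps star_add star_diff star_star sa)
  have C_swap: "C \<rho> \<sigma> \<mu> \<nu>" if "C \<mu> \<nu> \<rho> \<sigma>" for \<mu> \<nu> \<rho> \<sigma>
  proof -
    have "(cnj (F \<theta> (entry_wt \<mu> \<nu>) (entry_wt \<rho> \<sigma>)))\<^sup>2 * (F \<theta> (entry_wt \<mu> \<nu>) (entry_wt \<rho> \<sigma>))\<^sup>2 = 1"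
      by (simp flip: power_mult_distrib)
    then show ?thesis
      using that unfolding C_def by (simp add: F_swap[OF assms(1), of _ "entry_wt \<rho> \<sigma>"])
  qed
  have C_star: "C \<nu> \<mu> \<sigma> \<rho>" if "C \<mu> \<nu> \<rho> \<sigma>" for \<mu> \<nu> \<rho> \<sigma>
  proof -
    have "(proj_entry g \<mu> \<nu> \<odot> proj_entry g \<rho> \<sigma>)\<^sup>\<star>
      = ((F \<theta> (entry_wt \<mu> \<nu>) (entry_wt \<rho> \<sigma>))\<^sup>2 *s (proj_entry g \<rho> \<sigma> \<odot> proj_entry g \<mu> \<nu>))\<^sup>\<star>"
      using that unfolding C_def by simp
    \<comment> \<open>The star reverses products, so it exchanges the two entries besides
      transposing them; \<open>C_swap\<close> undoes the exchange.\<close>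
    then have "C \<sigma> \<rho> \<nu> \<mu>"
      unfolding C_def star_mult star_scale star_entry entry_wt_swap[of \<nu> \<mu>] entry_wt_swap[of \<sigma> \<rho>]
      by (simp add: F_uminus_left F_uminus_right F_swap[OF assms(1), of "entry_wt \<rho> \<sigma>"])
    then show ?thesis by (rule C_swap)
  qed
  have qcomm: "C \<mu> \<nu> \<rho> \<sigma> \<and> C \<mu> \<nu> \<sigma> \<rho> \<and> C \<nu> \<mu> \<rho> \<sigma> \<and> C \<nu> \<mu> \<sigma> \<rho> \<and>
      C \<rho> \<sigma> \<mu> \<nu> \<and> C \<sigma> \<rho> \<mu> \<nu> \<and> C \<rho> \<sigma> \<nu> \<mu> \<and> C \<sigma> \<rho> \<nu> \<mu>"
    if "qcomm (cis c) (proj_entry g \<mu> \<nu>) (proj_entry g \<rho> \<sigma>)"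
      "c = 2 * (\<theta> $ \<mu> $ \<rho> - \<theta> $ \<mu> $ \<sigma> - \<theta> $ \<nu> $ \<rho> + \<theta> $ \<nu> $ \<sigma>)" for c \<mu> \<nu> \<rho> \<sigma>
  proof -
    have "cis c = (F \<theta> (entry_wt \<mu> \<nu>) (entry_wt \<rho> \<sigma>))\<^sup>2"
      unfolding that(2) F_entry_wt power2_eq_square cis_mult mult_2 ..
    then have "C \<mu> \<nu> \<rho> \<sigma>" "C \<mu> \<nu> \<sigma> \<rho>"
      using that(1) unfolding qcomm_def star_entry C_def
      by (simp_all add: entry_wt_swap[of \<nu> \<mu>] entry_wt_swap[of \<sigma> \<rho>] F_uminus_left F_uminus_right)
    then show ?thesis using C_swap C_star by blast
  qed
  have diag: "\<theta> $ i $ i = 0" for i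
    using transpose_uminus_nth[OF assms(1), of i i] by simp
  note anti = transpose_uminus_nth[OF assms(1), of 2 1] transpose_uminus_nth[OF assms(1), of 3 1]
    transpose_uminus_nth[OF assms(1), of 4 1] transpose_uminus_nth[OF assms(1), of 3 2]
    transpose_uminus_nth[OF assms(1), of 4 2] transpose_uminus_nth[OF assms(1), of 4 3]
  note rel = assms(3)[unfolded commutation_relations_def Let_def theta_0_def theta_A_def theta_B_def]
  have off_diag:
    "qcomm (cis (2 * (\<theta> $ 1 $ 3 - \<theta> $ 1 $ 4 - \<theta> $ 2 $ 3 + \<theta> $ 2 $ 4))) (proj_entry g 1 2) (proj_entry g 3 4)"
    "qcomm (cis (2 * (\<theta> $ 1 $ 1 - \<theta> $ 1 $ 3 - \<theta> $ 2 $ 1 + \<theta> $ 2 $ 3))) (proj_entry g 1 2) (proj_entry g 1 3)"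
    "qcomm (cis (2 * (\<theta> $ 1 $ 1 - \<theta> $ 1 $ 4 - \<theta> $ 2 $ 1 + \<theta> $ 2 $ 4))) (proj_entry g 1 2) (proj_entry g 1 4)"
    "qcomm (cis (2 * (\<theta> $ 1 $ 2 - \<theta> $ 1 $ 3 - \<theta> $ 2 $ 2 + \<theta> $ 2 $ 3))) (proj_entry g 1 2) (proj_entry g 2 3)"
    "qcomm (cis (2 * (\<theta> $ 1 $ 2 - \<theta> $ 1 $ 4 - \<theta> $ 2 $ 2 + \<theta> $ 2 $ 4))) (proj_entry g 1 2) (proj_entry g 2 4)"
    "qcomm (cis (2 * (\<theta> $ 3 $ 1 - \<theta> $ 3 $ 3 - \<theta> $ 4 $ 1 + \<theta> $ 4 $ 3))) (proj_entry g 3 4) (proj_entry g 1 3)"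
    "qcomm (cis (2 * (\<theta> $ 3 $ 2 - \<theta> $ 3 $ 3 - \<theta> $ 4 $ 2 + \<theta> $ 4 $ 3))) (proj_entry g 3 4) (proj_entry g 2 3)"
    "qcomm (cis (2 * (\<theta> $ 3 $ 1 - \<theta> $ 3 $ 4 - \<theta> $ 4 $ 1 + \<theta> $ 4 $ 4))) (proj_entry g 3 4) (proj_entry g 1 4)"
    "qcomm (cis (2 * (\<theta> $ 3 $ 2 - \<theta> $ 3 $ 4 - \<theta> $ 4 $ 2 + \<theta> $ 4 $ 4))) (proj_entry g 3 4) (proj_entry g 2 4)"
    "qcomm (cis (2 * (\<theta> $ 1 $ 1 - \<theta> $ 1 $ 4 - \<theta> $ 3 $ 1 + \<theta> $ 3 $ 4))) (proj_entry g 1 3) (proj_entry g 1 4)"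
    "qcomm (cis (2 * (\<theta> $ 1 $ 2 - \<theta> $ 1 $ 3 - \<theta> $ 3 $ 2 + \<theta> $ 3 $ 3))) (proj_entry g 1 3) (proj_entry g 2 3)"
    "qcomm (cis (2 * (\<theta> $ 1 $ 2 - \<theta> $ 1 $ 4 - \<theta> $ 3 $ 2 + \<theta> $ 3 $ 4))) (proj_entry g 1 3) (proj_entry g 2 4)"
    "qcomm (cis (2 * (\<theta> $ 1 $ 2 - \<theta> $ 1 $ 3 - \<theta> $ 4 $ 2 + \<theta> $ 4 $ 3))) (proj_entry g 1 4) (proj_entry g 2 3)"
    "qcomm (cis (2 * (\<theta> $ 1 $ 2 - \<theta> $ 1 $ 4 - \<theta> $ 4 $ 2 + \<theta> $ 4 $ 4))) (proj_entry g 1 4) (proj_entry g 2 4)"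
    "qcomm (cis (2 * (\<theta> $ 2 $ 2 - \<theta> $ 2 $ 4 - \<theta> $ 3 $ 2 + \<theta> $ 3 $ 4))) (proj_entry g 2 3) (proj_entry g 2 4)"
    using rel by (simp_all add: proj_entry_simps diag anti algebra_simps)
  note off_diag = off_diag[THEN qcomm, OF refl]
  have central_diag: "C \<mu> \<mu> \<rho> \<sigma>" for \<mu> \<rho> \<sigma>
  proof -
    have entry: "g x \<odot> proj_entry g \<rho> \<sigma> = proj_entry g \<rho> \<sigma> \<odot> g x"
      if x: "x \<in> {Ga, Galpha3, Gdelta3}" for x
    proof -
      have "g x \<odot> (g y)\<^sup>\<star> = (g y)\<^sup>\<star> \<odot> g x" for y
        using arg_cong[OF central[OF x, of y], of star] by (simp add: star_mult sa[OF x])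
      then show ?thesis
        using exhaust_4[of \<rho>] exhaust_4[of \<sigma>] central[OF x]
        by (auto simp: proj_entry_simps mult_linear_simps)
    qed
    show ?thesis
      unfolding C_def using exhaust_4[of \<mu>] entry
      by (auto simp: proj_entry_simps(1,6,11,16) mult_linear_simps)
  qed
  have "C \<mu> \<nu> \<mu> \<nu> \<and> C \<mu> \<nu> \<nu> \<mu> \<and> C \<nu> \<mu> \<mu> \<nu> \<and> C \<nu> \<mu> \<nu> \<mu>"
    if "proj_entry g \<mu> \<nu> \<odot> (proj_entry g \<mu> \<nu>)\<^sup>\<star> = (proj_entry g \<mu> \<nu>)\<^sup>\<star> \<odot> proj_entry g \<mu> \<nu>" for \<mu> \<nu>
    using that unfolding C_def star_entry entry_wt_swap[of \<nu> \<mu>]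
    by (simp add: F_uminus_left F_uminus_right F_self[OF assms(1)])
  note self = this[of 1 2] this[of 1 3] this[of 1 4] this[of 2 3] this[of 2 4] this[of 3 4]
  note self = self[unfolded proj_entry_simps, OF normal]
  have "\<forall>\<mu> \<nu> \<rho> \<sigma>. C \<mu> \<nu> \<rho> \<sigma>"
    unfolding forall_4 by (simp add: central_diag central_diag[THEN C_swap] self off_diag)
  then show ?thesis unfolding C_def by blast
qed

lemma twisted_projector_iff_cm_relations:
  assumes "transpose \<theta> = - \<theta>"
  shows "twisted_projector scale (\<odot>) \<one> star \<theta> (proj_entry g) \<longleftrightarrow> cm_relations \<theta> g"
proof
  assume "twisted_projector scale (\<odot>) \<one> star \<theta> (proj_entry g)"
  then interpret Q: twisted_projector scale "(\<odot>)" \<one> star \<theta> "proj_entry g" .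
  have "trivial_relations g" "commutation_relations \<theta> g"
    using selfadjoint_relations[OF Q.twisted_projector_axioms]
      commutation_relations_proj_entry[OF Q.twisted_projector_axioms] by blast+
  then show "cm_relations \<theta> g"
    using proj_entry_idempotent_iff Q.Q_proj unfolding cm_relations_def by blast
next
  assume rel: "cm_relations \<theta> g"
  show "twisted_projector scale (\<odot>) \<one> star \<theta> (proj_entry g)"
  proof unfold_locales
    have "(g x)\<^sup>\<star> = g x" if "x \<in> {Ga, Galpha3, Gdelta3}" for x
      using rel that unfolding cm_relations_def trivial_relations_def by blast
    then show "(proj_entry g \<mu> \<nu>)\<^sup>\<star> = proj_entry g \<nu> \<mu>" for \<mu> \<nu>
      using exhaust_4[of \<mu>] exhaust_4[of \<nu>]
      by (auto simp: proj_entry_simps star_add star_diff star_star)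
    show "proj_entry g \<mu> \<nu> \<odot> proj_entry g \<rho> \<sigma>
      = (F \<theta> (entry_wt \<mu> \<nu>) (entry_wt \<rho> \<sigma>))\<^sup>2 *s (proj_entry g \<rho> \<sigma> \<odot> proj_entry g \<mu> \<nu>)" for \<mu> \<nu> \<rho> \<sigma>
      using proj_entry_Q_commute assms rel unfolding cm_relations_def by blast
    show "(\<Sum>\<nu>\<in>UNIV. proj_entry g \<mu> \<nu> \<odot> proj_entry g \<nu> \<rho>) = proj_entry g \<mu> \<rho>" for \<mu> \<rho>
      using proj_entry_idempotent_iff rel unfolding cm_relations_def by blast
    show "(\<Sum>\<mu>\<in>UNIV. proj_entry g \<mu> \<mu>) = 2 *s \<one>"
      by (simp add: sum_4 proj_entry_simps scale_two)
  qed (rule assms)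
qed

end

section \<open>The twisted coordinate algebra\<close>

lemma wt_map_key_swap: "wt (Poly_Mapping.map_key prod.swap m) = - wt m"
  by (simp add: wt_def vec_eq_iff map_key.rep_eq)

lemma map_key_swap_swap: "Poly_Mapping.map_key prod.swap (Poly_Mapping.map_key prod.swap m) = (m :: mono)"
  by (rule poly_mapping_eqI) (simp add: map_key.rep_eq)

text \<open>A bicharacter is a 2-cocycle: both bracketings of three monomials acquire the product of
  the three pairwise phases.\<close>

lemma poly_tw_assoc: "poly_tw \<theta> (poly_tw \<theta> p q) r = poly_tw \<theta> p (poly_tw \<theta> q r)"
proof (induction p rule: cpoly_induct)
  case p: (single m c)
  show ?case
  proof (induction q rule: cpoly_induct)
    case q: (single n d)
    show ?case
      by (induction r rule: cpoly_induct)
        (simp_all add: poly_tw_add_right wt_add F_add_left F_add_right add.assoc mult_ac)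
  qed (simp add: poly_tw_add_left poly_tw_add_right)
qed (simp add: poly_tw_add_left)

lemma poly_star_star: "poly_star (poly_star p) = p"
  by (induction p rule: cpoly_induct) (simp_all add: poly_star_add map_key_swap_swap)

text \<open>The star negates both weights, which leaves \<open>F\<close> unchanged. It also
  conjugates the phase, and by antisymmetry this is the phase of the two factors in the opposite
  order.\<close>

lemma poly_star_tw:
  assumes "transpose \<theta> = - \<theta>"
  shows "poly_star (poly_tw \<theta> p q) = poly_tw \<theta> (poly_star q) (poly_star p)"
proof (induction p rule: cpoly_induct)
  case p: (single m c)
  show ?case
    by (induction q rule: cpoly_induct)
      (simp_all add: poly_tw_add_left poly_tw_add_right poly_star_add map_key_plus wt_map_key_swap
        F_uminus_left F_uminus_right F_swap[OF assms, of "wt m"] add.commute mult_ac)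
qed (simp add: poly_tw_add_left poly_tw_add_right poly_star_add)

lemma poly_tw_zero: "poly_tw 0 p q = p * q"
  using poly_tw_homog[of p q 0 1] by (simp add: F_def)

lemma poly_tw_scale_left: "poly_tw \<theta> (Poly_Mapping.single 0 c * p) q = Poly_Mapping.single 0 c * poly_tw \<theta> p q"
proof (induction p rule: cpoly_induct)
  case p: (single m d)
  show ?case
    by (induction q rule: cpoly_induct)
      (simp_all add: poly_tw_add_right mult_single algebra_simps)
qed (simp add: poly_tw_add_left algebra_simps)

lemma poly_tw_scale_right: "poly_tw \<theta> p (Poly_Mapping.single 0 c * q) = Poly_Mapping.single 0 c * poly_tw \<theta> p q"
proof (induction p rule: cpoly_induct)
  case p: (single m d)
  show ?case
    by (induction q rule: cpoly_induct)
      (simp_all add: poly_tw_add_right mult_single algebra_simps)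
qed (simp add: poly_tw_add_left algebra_simps)

lemma poly_tw_one: "poly_tw \<theta> 1 p = p" "poly_tw \<theta> p 1 = p"
  using poly_tw_homog[of 1 p \<theta> 1] poly_tw_homog[of p 1 \<theta> 1] by (simp_all add: wt_0)

section \<open>The *-algebra structure on the quotient\<close>

lemma vector_space_cm_scale: "vector_space cm_scale"
proof
  show "cm_scale a (x + y) = cm_scale a x + cm_scale a y" for a x y
    by transfer (rule cm_eqI, rule distrib_left)
  show "cm_scale (a + b) x = cm_scale a x + cm_scale b x" for a b x
    by transfer (rule cm_eqI, simp add: single_add distrib_right)
  show "cm_scale a (cm_scale b x) = cm_scale (a * b) x" for a b x
    by transfer (rule cm_eqI, simp add: mult_single flip: mult.assoc)
  show "cm_scale 1 x = x" for x
    by transfer (rule cm_eqI, simp)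
qed

interpretation cm: vector_space cm_scale
  by (rule vector_space_cm_scale)

lemma star_algebra_cm_tw:
  assumes "transpose \<theta> = - \<theta>"
  shows "star_algebra cm_scale (cm_tw \<theta>) 1 cm_star"
proof
  fix x y z :: cm and c :: complex
  show "cm_tw \<theta> (cm_tw \<theta> x y) z = cm_tw \<theta> x (cm_tw \<theta> y z)"
    by transfer (rule cm_eqI, rule poly_tw_assoc)
  show "cm_tw \<theta> 1 x = x" "cm_tw \<theta> x 1 = x"
    by (transfer, rule cm_eqI, rule poly_tw_one)+
  show "cm_tw \<theta> x (y + z) = cm_tw \<theta> x y + cm_tw \<theta> x z" by (rule cm_tw_add_right)
  show "cm_tw \<theta> (x + y) z = cm_tw \<theta> x z + cm_tw \<theta> y z" by (rule cm_tw_add_left)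
  show "cm_tw \<theta> (cm_scale c x) y = cm_scale c (cm_tw \<theta> x y)"
    by transfer (rule cm_eqI, rule poly_tw_scale_left)
  show "cm_tw \<theta> x (cm_scale c y) = cm_scale c (cm_tw \<theta> x y)"
    by transfer (rule cm_eqI, rule poly_tw_scale_right)
  show "cm_star (cm_star x) = x" by transfer (rule cm_eqI, rule poly_star_star)
  show "cm_star (x + y) = cm_star x + cm_star y" by transfer (rule cm_eqI, rule poly_star_add)
  show "cm_star (cm_scale c x) = cm_scale (cnj c) (cm_star x)"
    by transfer (rule cm_eqI, simp add: poly_star_mult)
  show "cm_star (cm_tw \<theta> x y) = cm_tw \<theta> (cm_star y) (cm_star x)"
    by (transfer fixing: \<theta>) (rule cm_eqI, rule poly_star_tw[OF assms])
qed

lemma cm_tw_zero: "cm_tw 0 = (*)"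
proof (intro ext)
  show "cm_tw 0 x y = x * y" for x y by transfer (rule cm_eqI, rule poly_tw_zero)
qed

lemma cm_Phat_zero: "cm_Phat 0 = cm_P"
  by (simp add: cm_Phat_def vec_eq_iff)

section \<open>P-hat as a twisted projector\<close>

lemma cm_Phat_nth: "cm_Phat \<theta> $ \<mu> $ \<nu> = cm_scale (cis (- \<theta> $ \<mu> $ \<nu>)) (cm_entry \<mu> \<nu>)"
  by (simp add: cm_Phat_def cm_P_def)

lemma cm_Phat_abs: "cm_Phat \<theta> $ \<mu> $ \<nu>
    = abs_cm (Poly_Mapping.single (Poly_Mapping.single (\<mu>, \<nu>) 1) (cis (- \<theta> $ \<mu> $ \<nu>)))"
  by (simp add: cm_Phat_nth cm_entry.abs_eq cm_scale.abs_eq pvar_def mult_single)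

lemma cm_tw_entry: "cm_tw \<theta> (cm_entry \<mu> \<nu>) (cm_entry \<rho> \<sigma>)
    = cm_scale (F \<theta> (entry_wt \<mu> \<nu>) (entry_wt \<rho> \<sigma>)) (cm_entry \<mu> \<nu> * cm_entry \<rho> \<sigma>)"
  by transfer (rule cm_eqI, simp add: pvar_def wt_single mult_single entry_wt_def del: One_nat_def)

lemma cm_star_entry: "cm_star (cm_entry \<mu> \<nu>) = cm_entry \<nu> \<mu>"
  by transfer (rule cm_eqI, rule poly_star_pvar)

lemma abs_cm_sum: "abs_cm (sum f A) = (\<Sum>x\<in>A. abs_cm (f x))"
  by (induction A rule: infinite_finite_induct)
    (simp_all add: zero_cm_def plus_cm.abs_eq[symmetric])

lemma cm_entry_proj: "(\<Sum>\<nu>\<in>UNIV. cm_entry \<mu> \<nu> * cm_entry \<nu> \<rho>) = cm_entry \<mu> \<rho>"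
proof -
  have "cm_eq (\<Sum>\<nu>\<in>UNIV. pvar \<mu> \<nu> * pvar \<nu> \<rho>) (pvar \<mu> \<rho>)"
    using prel_ideal[of \<mu> \<rho>] by (simp add: cm_eq_def prel_def)
  then have "abs_cm (\<Sum>\<nu>\<in>UNIV. pvar \<mu> \<nu> * pvar \<nu> \<rho>) = abs_cm (pvar \<mu> \<rho>)"
    by (simp add: cm.abs_eq_iff)
  then show ?thesis by (simp add: abs_cm_sum cm_entry.abs_eq times_cm.abs_eq)
qed

lemma cm_entry_trace: "(\<Sum>\<mu>\<in>UNIV. cm_entry \<mu> \<mu>) = cm_scale 2 1"
proof -
  have "cm_eq (\<Sum>\<mu>\<in>UNIV. pvar \<mu> \<mu>) (Poly_Mapping.single 0 2 * 1)"
    using trel_ideal by (simp add: cm_eq_def trel_def)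
  then have "abs_cm (\<Sum>\<mu>\<in>UNIV. pvar \<mu> \<mu>) = abs_cm (Poly_Mapping.single 0 2 * 1)"
    by (simp add: cm.abs_eq_iff)
  then show ?thesis by (simp add: abs_cm_sum cm_entry.abs_eq one_cm_def cm_scale.abs_eq)
qed

lemma twisted_projector_cm_Phat:
  assumes "transpose \<theta> = - \<theta>"
  shows "twisted_projector cm_scale (cm_tw \<theta>) 1 cm_star \<theta> (\<lambda>\<mu> \<nu>. cm_Phat \<theta> $ \<mu> $ \<nu>)"
proof -
  interpret star_algebra cm_scale "cm_tw \<theta>" 1 cm_star
    by (rule star_algebra_cm_tw[OF assms])
  have tw: "cm_tw \<theta> (cm_Phat \<theta> $ \<mu> $ \<nu>) (cm_Phat \<theta> $ \<rho> $ \<sigma>)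
      = cm_scale (cis (- \<theta> $ \<mu> $ \<nu>) * cis (- \<theta> $ \<rho> $ \<sigma>) * F \<theta> (entry_wt \<mu> \<nu>) (entry_wt \<rho> \<sigma>))
          (cm_entry \<mu> \<nu> * cm_entry \<rho> \<sigma>)" for \<mu> \<nu> \<rho> \<sigma>
    by (simp add: cm_Phat_nth scale_mult_left scale_mult_right cm_tw_entry mult_ac)
  have diag: "\<theta> $ i $ i = 0" for i
    using transpose_uminus_nth[OF assms, of i i] by simp
  show ?thesis
  proof unfold_locales
    show "cm_star (cm_Phat \<theta> $ \<mu> $ \<nu>) = cm_Phat \<theta> $ \<nu> $ \<mu>" for \<mu> \<nu>
      by (simp add: cm_Phat_nth star_scale cm_star_entry cis_cnj transpose_uminus_nth[OF assms, of \<nu> \<mu>])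
    show "cm_tw \<theta> (cm_Phat \<theta> $ \<mu> $ \<nu>) (cm_Phat \<theta> $ \<rho> $ \<sigma>)
        = cm_scale ((F \<theta> (entry_wt \<mu> \<nu>) (entry_wt \<rho> \<sigma>))\<^sup>2)
            (cm_tw \<theta> (cm_Phat \<theta> $ \<rho> $ \<sigma>) (cm_Phat \<theta> $ \<mu> $ \<nu>))" for \<mu> \<nu> \<rho> \<sigma>
      unfolding tw F_swap[OF assms, of "entry_wt \<rho> \<sigma>"]
      by (simp add: power2_eq_square mult_ac)
    \<comment> \<open>This fixes the phases in P-hat: on composable entries \<open>F\<close>
      contributes the angle \<open>\<theta> $ \<mu> $ \<nu> + \<theta> $ \<nu> $ \<rho> - \<theta> $
      \<mu> $ \<rho>\<close>, and the two phases of the factors cancel all but its last term. What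
      remains is independent of the summation index, and the classical relation applies.\<close>
    have "cm_tw \<theta> (cm_Phat \<theta> $ \<mu> $ \<nu>) (cm_Phat \<theta> $ \<nu> $ \<rho>)
        = cm_scale (cis (- \<theta> $ \<mu> $ \<rho>)) (cm_entry \<mu> \<nu> * cm_entry \<nu> \<rho>)" for \<mu> \<nu> \<rho>
      unfolding tw F_entry_wt cis_mult by (simp add: diag)
    then show "(\<Sum>\<nu>\<in>UNIV. cm_tw \<theta> (cm_Phat \<theta> $ \<mu> $ \<nu>) (cm_Phat \<theta> $ \<nu> $ \<rho>)) = cm_Phat \<theta> $ \<mu> $ \<rho>" for \<mu> \<rho>
      by (simp add: cm_entry_proj cm_Phat_nth flip: cm.scale_sum_right)
    show "(\<Sum>\<mu>\<in>UNIV. cm_Phat \<theta> $ \<mu> $ \<mu>) = cm_scale 2 1"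
      by (simp add: cm_Phat_nth diag cm_entry_trace)
  qed (rule assms)
qed

lemma gen_matrix_gens_of:
  assumes "\<And>\<mu> \<nu>. cm_star (P $ \<mu> $ \<nu>) = P $ \<nu> $ \<mu>"
    and tr: "(\<Sum>\<mu>\<in>UNIV. P $ \<mu> $ \<mu>) = cm_scale 2 1"
  shows "gen_matrix (gens_of P) = P"
proof -
  have half: "cm_scale (1/2) x + cm_scale (1/2) x = x" for x
    by (simp flip: cm.scale_left_distrib)
  \<comment> \<open>Half the trace is the unit; this supplies the 1 in the entries 1 - a plus or
    minus \<delta>3 of the lower block.\<close>
  have one: "1 = cm_scale (1/2) (P $ 1 $ 1 + P $ 2 $ 2 + P $ 3 $ 3 + P $ 4 $ 4)"
    using arg_cong[OF tr, of "cm_scale (1/2)"] by (simp add: sum_4)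
  have "cm_scale (1/2) (x + y) + cm_scale (1/2) (x - y) = x" for x y
    using half[of x] by (simp add: cm.scale_right_distrib cm.scale_right_diff_distrib)
  moreover have "cm_scale (1/2) (x + y) - cm_scale (1/2) (x - y) = y" for x y
    using half[of y] by (simp add: cm.scale_right_distrib cm.scale_right_diff_distrib algebra_simps)
  moreover have "1 - cm_scale (1/2) (P $ 1 $ 1 + P $ 2 $ 2) + cm_scale (1/2) (P $ 3 $ 3 - P $ 4 $ 4) = P $ 3 $ 3"
    using half[of "P $ 3 $ 3"] unfolding one
    by (simp add: cm.scale_right_distrib cm.scale_right_diff_distrib algebra_simps)
  moreover have "1 - cm_scale (1/2) (P $ 1 $ 1 + P $ 2 $ 2) - cm_scale (1/2) (P $ 3 $ 3 - P $ 4 $ 4) = P $ 4 $ 4"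
    using half[of "P $ 4 $ 4"] unfolding one
    by (simp add: cm.scale_right_distrib cm.scale_right_diff_distrib algebra_simps)
  ultimately show ?thesis
    unfolding vec_eq_iff forall_4 gen_matrix_def by (simp add: assms(1))
qed

lemma gen_matrix_gens_of_cm_Phat:
  assumes "transpose \<theta> = - \<theta>"
  shows "gen_matrix (gens_of (cm_Phat \<theta>)) = cm_Phat \<theta>"
proof -
  interpret twisted_projector cm_scale "cm_tw \<theta>" 1 cm_star \<theta> "\<lambda>\<mu> \<nu>. cm_Phat \<theta> $ \<mu> $ \<nu>"
    by (rule twisted_projector_cm_Phat[OF assms])
  show ?thesis by (rule gen_matrix_gens_of[OF star_Q Q_trace])
qed

lemma cm_tw_entry_diag: "cm_tw \<theta> (cm_entry \<mu> \<mu>) f = cm_entry \<mu> \<mu> * f" "cm_tw \<theta> f (cm_entry \<mu> \<mu>) = f * cm_entry \<mu> \<mu>"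
proof -
  have "F \<theta> (wt m) b = 1" "F \<theta> b (wt m) = 1" if "m \<in> Poly_Mapping.keys (pvar \<mu> \<mu>)" for m b
    using keys_pvar[OF that] by simp_all
  then have "poly_tw \<theta> (pvar \<mu> \<mu>) p = pvar \<mu> \<mu> * p" "poly_tw \<theta> p (pvar \<mu> \<mu>) = p * pvar \<mu> \<mu>" for p
    using poly_tw_homog[of "pvar \<mu> \<mu>" p \<theta> 1] poly_tw_homog[of p "pvar \<mu> \<mu>" \<theta> 1] by simp_all
  then show "cm_tw \<theta> (cm_entry \<mu> \<mu>) f = cm_entry \<mu> \<mu> * f" "cm_tw \<theta> f (cm_entry \<mu> \<mu>) = f * cm_entry \<mu> \<mu>"
    by (transfer, simp add: cm_eqI)+
qed

text \<open>\<open>trivial_relations\<close> only compares generators with each other. Centrality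
  among all elements holds because the twist is trivial against weight zero, where the product is
  the commutative one.\<close>

lemma gens_of_cm_Phat_central:
  assumes "transpose \<theta> = - \<theta>" "x \<in> {Ga, Galpha3, Gdelta3}"
  shows "cm_tw \<theta> (gens_of (cm_Phat \<theta>) x) f = cm_tw \<theta> f (gens_of (cm_Phat \<theta>) x)"
proof -
  interpret star_algebra cm_scale "cm_tw \<theta>" 1 cm_star
    by (rule star_algebra_cm_tw[OF assms(1)])
  have "cm_tw \<theta> (cm_Phat \<theta> $ \<mu> $ \<mu>) f = cm_tw \<theta> f (cm_Phat \<theta> $ \<mu> $ \<mu>)" for \<mu>
    by (simp add: cm_Phat_nth scale_mult_left scale_mult_right cm_tw_entry_diag mult.commute)
  then show ?thesis
    using assms(2) by (auto simp: scale_mult_left scale_mult_right mult_linear_simps)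
qed

lemma cm_relations_gens_of_cm_Phat:
  assumes "transpose \<theta> = - \<theta>"
  shows "star_algebra.cm_relations cm_scale (cm_tw \<theta>) 1 cm_star \<theta> (gens_of (cm_Phat \<theta>))"
proof -
  interpret star_algebra cm_scale "cm_tw \<theta>" 1 cm_star
    by (rule star_algebra_cm_tw[OF assms])
  have "proj_entry (gens_of (cm_Phat \<theta>)) = (\<lambda>\<mu> \<nu>. cm_Phat \<theta> $ \<mu> $ \<nu>)"
    by (intro ext) (metis gen_matrix_def proj_entry_def gen_matrix_gens_of_cm_Phat[OF assms])
  then show ?thesis
    using twisted_projector_iff_cm_relations[OF assms] twisted_projector_cm_Phat[OF assms] by metis
qed

section \<open>The universal property\<close>

lemma mono_induct [case_names zero add]:
  fixes m :: mono
  assumes "P 0" and step: "\<And>i m. P m \<Longrightarrow> P (Poly_Mapping.single i 1 + m)"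
  shows "P m"
proof (induction "\<Sum>i\<in>UNIV. Poly_Mapping.lookup m i" arbitrary: m)
  case 0
  then have "Poly_Mapping.lookup m i = 0" for i by (cases i) simp
  then have "m = 0" by (intro poly_mapping_eqI) simp
  then show ?case using assms(1) by simp
next
  case (Suc k)
  then obtain i where i: "Poly_Mapping.lookup m i \<noteq> 0"
    by (metis Zero_not_Suc sum.neutral)
  \<comment> \<open>Subtraction of exponents is truncated, but the exponent of \<open>i\<close> is
    positive, so nothing is lost.\<close>
  define n where "n = m - Poly_Mapping.single i 1"
  have m: "m = Poly_Mapping.single i 1 + n"
    unfolding n_def using i
    by (intro poly_mapping_eqI) (auto simp: lookup_add lookup_minus lookup_single when_def)
  have "(\<Sum>j\<in>UNIV. Poly_Mapping.lookup (Poly_Mapping.single i (1::nat)) j) = 1"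
    by (simp add: lookup_single when_def)
  then have "k = (\<Sum>j\<in>UNIV. Poly_Mapping.lookup n j)"
    using Suc(2) unfolding m lookup_add sum.distrib by simp
  then show ?case unfolding m by (intro step Suc(1))
qed

text \<open>The passage to multisets makes \<open>fold_mset\<close> available, which evaluates a
  product without choosing an order as soon as the single steps commute.\<close>

definition mono_mset :: "mono \<Rightarrow> (4 \<times> 4) multiset" where
  "mono_mset m = Abs_multiset (Poly_Mapping.lookup m)"

lemma count_mono_mset: "count (mono_mset m) = Poly_Mapping.lookup m"
  unfolding mono_mset_def by (rule count_Abs_multiset) simp

lemma mono_mset_zero [simp]: "mono_mset 0 = {#}"
  by (rule multiset_eqI) (simp add: count_mono_mset)

lemma mono_mset_add: "mono_mset (Poly_Mapping.single i 1 + m) = add_mset i (mono_mset m)"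
  by (rule multiset_eqI) (simp add: count_mono_mset lookup_add lookup_single when_def)

lemma wt_single_entry: "wt (Poly_Mapping.single i 1) = entry_wt (fst i) (snd i)"
  by (cases i) (simp add: wt_single entry_wt_def del: One_nat_def)

lemma cm_eq_rep_abs: "cm_eq (rep_cm (abs_cm p)) p"
  by (rule Quotient3_rep_abs[OF Quotient3_cm]) (rule equivp_reflp[OF equivp_cm_eq])

lemma abs_cm_cases: obtains p where "x = abs_cm p"
  using Quotient3_abs_rep[OF Quotient3_cm, of x] by metis

section \<open>Evaluation at a twisted projector\<close>

context twisted_projector
begin

text \<open>The phase undoes the one in \<open>cm_Phat\<close>: if P-hat goes to \<open>Q\<close>,
  this is where the entry of P itself must go.\<close>

definition entry_val :: "4 \<times> 4 \<Rightarrow> 'a" where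
  "entry_val i = cis (\<theta> $ fst i $ snd i) *s Q (fst i) (snd i)"

lemma entry_val_commute: "entry_val i \<odot> entry_val j = (F \<theta> (wt (Poly_Mapping.single i 1)) (wt (Poly_Mapping.single j 1)))\<^sup>2 *s (entry_val j \<odot> entry_val i)"
  unfolding entry_val_def wt_single_entry scale_mult_left scale_mult_right
  by (subst Q_commute) (simp add: mult_ac)

lemma star_entry_val: "(entry_val (\<mu>, \<nu>))\<^sup>\<star> = entry_val (\<nu>, \<mu>)"
  by (simp add: entry_val_def star_scale star_Q cis_cnj transpose_uminus_nth[OF antisym, of \<nu> \<mu>])

text \<open>The phase is the inverse of the one that the twisted product puts in front of the new factor,
  which makes the operators for different indices commute.\<close>

definition cons_factor :: "4 \<times> 4 \<Rightarrow> 'a \<times> (int^4) \<Rightarrow> 'a \<times> (int^4)" where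
  "cons_factor i y = (cnj (F \<theta> (wt (Poly_Mapping.single i 1)) (snd y)) *s (entry_val i \<odot> fst y),
     wt (Poly_Mapping.single i 1) + snd y)"

text \<open>Exchanging two entries costs the square of \<open>F\<close>, and the corrections for the
  two orders are conjugate to each other, so they differ by exactly that square. The phases against
  the weight accumulated before are the same in both orders.\<close>

lemma comp_fun_commute_cons_factor: "comp_fun_commute cons_factor"
proof
  fix i j
  let ?i = "wt (Poly_Mapping.single i 1)" and ?j = "wt (Poly_Mapping.single j 1)"
  have "cnj (F \<theta> ?j ?i) *s (entry_val j \<odot> (entry_val i \<odot> x)) = cnj (F \<theta> ?i ?j) *s (entry_val i \<odot> (entry_val j \<odot> x))" for x
  proof -
    have "entry_val j \<odot> (entry_val i \<odot> x) = (F \<theta> ?j ?i)\<^sup>2 *s (entry_val i \<odot> (entry_val j \<odot> x))"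
      by (metis entry_val_commute mult_assoc scale_mult_left)
    moreover have "cnj (F \<theta> ?j ?i) * (F \<theta> ?j ?i)\<^sup>2 = F \<theta> ?j ?i"
      by (simp add: power2_eq_square flip: mult.assoc)
    ultimately show ?thesis by (simp add: F_swap[OF antisym, of ?j ?i] del: One_nat_def)
  qed
  then have "(cnj (F \<theta> ?j b) * cnj (F \<theta> ?i b)) *s (cnj (F \<theta> ?j ?i) *s (entry_val j \<odot> (entry_val i \<odot> x)))
      = (cnj (F \<theta> ?j b) * cnj (F \<theta> ?i b)) *s (cnj (F \<theta> ?i ?j) *s (entry_val i \<odot> (entry_val j \<odot> x)))" for x b
    by simp
  then show "cons_factor j \<circ> cons_factor i = cons_factor i \<circ> cons_factor j"
    by (auto simp: cons_factor_def fun_eq_iff F_add_right scale_mult_right add_ac mult_ac simp del: One_nat_def)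
qed

definition mono_val :: "mono \<Rightarrow> 'a" where
  "mono_val m = fst (fold_mset cons_factor (\<one>, 0) (mono_mset m))"

lemma mono_val_zero [simp]: "mono_val 0 = \<one>"
  by (simp add: mono_val_def)

text \<open>The second component of the fold records the weight, so the phase can be read off from
  the monomial. This recursion replaces the fold from here on.\<close>

lemma mono_val_Cons: "mono_val (Poly_Mapping.single i 1 + m)
    = cnj (F \<theta> (wt (Poly_Mapping.single i 1)) (wt m)) *s (entry_val i \<odot> mono_val m)"
proof -
  note fold = comp_fun_commute.fold_mset_add_mset[OF comp_fun_commute_cons_factor]
  have "snd (fold_mset cons_factor (\<one>, 0) (mono_mset m)) = wt m"
  proof (induction m rule: mono_induct)
    case (add i m)
    then show ?case
      unfolding mono_mset_add fold wt_add by (subst cons_factor_def) simp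
  qed (simp add: wt_0)
  then show ?thesis
    unfolding mono_val_def mono_mset_add fold by (subst cons_factor_def) simp
qed

lemma mono_val_single: "mono_val (Poly_Mapping.single i 1) = entry_val i"
  using mono_val_Cons[of i 0] by (simp add: wt_0 one_right)

text \<open>The factor on the left is the one that \<open>poly_tw\<close> attaches to the product of
  the two monomials. In the induction, the phase of the new variable against \<open>n\<close> enters
  once through the bicharacter and once, conjugated, through the recursion, and cancels.\<close>

lemma mono_val_add: "F \<theta> (wt m) (wt n) *s mono_val (m + n) = mono_val m \<odot> mono_val n"
proof (induction m rule: mono_induct)
  case zero
  then show ?case by (simp add: wt_0 one_left)
next
  case (add i m)
  let ?i = "wt (Poly_Mapping.single i 1)"
  have "F \<theta> (?i + wt m) (wt n) *s mono_val (Poly_Mapping.single i 1 + (m + n))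
      = (F \<theta> ?i (wt n) * cnj (F \<theta> ?i (wt n))) *s cnj (F \<theta> ?i (wt m)) *s (entry_val i \<odot> F \<theta> (wt m) (wt n) *s mono_val (m + n))"
    by (simp only: mono_val_Cons wt_add F_add_left F_add_right scale_scale scale_mult_right complex_cnj_mult mult_ac)
  also have "\<dots> = mono_val (Poly_Mapping.single i 1 + m) \<odot> mono_val n"
    unfolding add mono_val_Cons by (simp add: scale_mult_left mult_assoc)
  finally show ?case by (simp only: wt_add add.assoc)
qed

lemma mono_val_swap: "mono_val (Poly_Mapping.map_key prod.swap m) = (mono_val m)\<^sup>\<star>"
proof (induction m rule: mono_induct)
  case (add i m)
  let ?i = "Poly_Mapping.single i (1::nat)"
  have swap: "Poly_Mapping.map_key prod.swap ?i = Poly_Mapping.single (prod.swap i) 1"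
    using map_key_single[of "prod.swap :: 4 \<times> 4 \<Rightarrow> 4 \<times> 4" "prod.swap i" "1::nat"] by simp
  \<comment> \<open>The recursion adds a variable in front, but the star will reverse the order.
    Hence the variable is first moved to the end, using that monomials commute.\<close>
  have "mono_val (?i + m) = (cnj (F \<theta> (wt m) (wt ?i))) *s (F \<theta> (wt m) (wt ?i) *s mono_val (m + ?i))"
    by (simp add: add.commute)
  also have "\<dots> = F \<theta> (wt ?i) (wt m) *s (mono_val m \<odot> entry_val i)"
    unfolding mono_val_add mono_val_single by (simp add: F_swap[OF antisym, of "wt ?i" "wt m"] del: One_nat_def)
  finally have "(mono_val (?i + m))\<^sup>\<star> = cnj (F \<theta> (wt ?i) (wt m)) *s ((entry_val i)\<^sup>\<star> \<odot> (mono_val m)\<^sup>\<star>)"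
    by (simp add: star_scale star_mult)
  also have "(entry_val i)\<^sup>\<star> = entry_val (prod.swap i)"
    by (cases i) (simp add: star_entry_val)
  also have "F \<theta> (wt ?i) (wt m) = F \<theta> (wt (Poly_Mapping.single (prod.swap i) 1)) (wt (Poly_Mapping.map_key prod.swap m))"
    by (simp add: wt_map_key_swap F_uminus_left F_uminus_right flip: swap del: One_nat_def)
  finally show ?case
    by (simp only: map_key_plus inj_swap swap mono_val_Cons add)
qed simp

definition poly_val :: "cpoly \<Rightarrow> 'a" where
  "poly_val p = (\<Sum>m\<in>Poly_Mapping.keys p. Poly_Mapping.lookup p m *s mono_val m)"

lemma poly_val_single [simp]: "poly_val (Poly_Mapping.single m c) = c *s mono_val m"
  by (simp add: poly_val_def)

lemma poly_val_add: "poly_val (p + q) = poly_val p + poly_val q"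
  unfolding poly_val_def
  by (rule setsum_keys_plus_distrib) (simp_all add: scale_left_distrib)

lemma poly_val_zero [simp]: "poly_val 0 = 0"
  by (simp add: poly_val_def)

lemma poly_val_diff: "poly_val (p - q) = poly_val p - poly_val q"
  using poly_val_add[of "p - q" q] by simp

lemma poly_val_sum: "poly_val (sum f A) = (\<Sum>x\<in>A. poly_val (f x))"
  by (induction A rule: infinite_finite_induct) (simp_all add: poly_val_add)

lemma poly_val_scale: "poly_val (Poly_Mapping.single 0 c * p) = c *s poly_val p"
  by (induction p rule: cpoly_induct)
    (simp_all add: mult_single poly_val_add distrib_left scale_right_distrib)

lemma poly_val_tw: "poly_val (poly_tw \<theta> p q) = poly_val p \<odot> poly_val q"
proof (induction p rule: cpoly_induct)
  case p: (single m c)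
  show ?case
  proof (induction q rule: cpoly_induct)
    case q: (single n d)
    show ?case
      by (simp add: scale_mult_left scale_mult_right mult_ac flip: mono_val_add)
  qed (simp add: poly_tw_add_right poly_val_add distrib_left')
qed (simp add: poly_tw_add_left poly_val_add distrib_right')

lemma poly_val_star: "poly_val (poly_star p) = (poly_val p)\<^sup>\<star>"
  by (induction p rule: cpoly_induct)
    (simp_all add: poly_star_add poly_val_add star_add star_scale mono_val_swap)

lemma poly_val_pvar: "poly_val (pvar \<mu> \<nu>) = entry_val (\<mu>, \<nu>)"
  by (simp add: pvar_def mono_val_single del: One_nat_def)

text \<open>The cancellation that makes P-hat idempotent, read backwards: the phases of the two
  entries and the untwisting phase combine to one that does not depend on the summation index, so
  idempotency of \<open>Q\<close> can be used.\<close>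

lemma poly_val_prel: "poly_val (prel \<mu> \<rho>) = 0"
proof -
  have diag: "\<theta> $ i $ i = 0" for i
    using transpose_uminus_nth[OF antisym, of i i] by simp
  have "poly_val (pvar \<mu> \<nu> * pvar \<nu> \<rho>) = cis (\<theta> $ \<mu> $ \<rho>) *s (Q \<mu> \<nu> \<odot> Q \<nu> \<rho>)" for \<nu>
  proof -
    have "poly_val (pvar \<mu> \<nu> * pvar \<nu> \<rho>)
        = cnj (F \<theta> (entry_wt \<mu> \<nu>) (entry_wt \<nu> \<rho>)) *s (entry_val (\<mu>, \<nu>) \<odot> entry_val (\<nu>, \<rho>))"
      using mono_val_Cons[of "(\<mu>, \<nu>)" "Poly_Mapping.single (\<nu>, \<rho>) 1"]
      by (simp add: pvar_def mult_single mono_val_single wt_single_entry del: One_nat_def)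
    also have "\<dots> = (cis (\<theta> $ \<mu> $ \<nu>) * cis (\<theta> $ \<nu> $ \<rho>) * cis (- (\<theta> $ \<mu> $ \<nu> - \<theta> $ \<mu> $ \<rho> - \<theta> $ \<nu> $ \<nu> + \<theta> $ \<nu> $ \<rho>))) *s (Q \<mu> \<nu> \<odot> Q \<nu> \<rho>)"
      by (simp add: entry_val_def scale_mult_left scale_mult_right F_entry_wt cis_cnj mult_ac)
    also have "\<dots> = cis (\<theta> $ \<mu> $ \<rho>) *s (Q \<mu> \<nu> \<odot> Q \<nu> \<rho>)"
      unfolding cis_mult by (simp add: diag)
    finally show ?thesis .
  qed
  then show ?thesis
    by (simp add: prel_def poly_val_diff poly_val_sum poly_val_pvar entry_val_def Q_proj flip: scale_sum_right)
qed

lemma poly_val_trel: "poly_val trel = 0"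
proof -
  have "\<theta> $ i $ i = 0" for i
    using transpose_uminus_nth[OF antisym, of i i] by simp
  then have "(\<Sum>\<mu>\<in>UNIV. entry_val (\<mu>, \<mu>)) = scale 2 \<one>"
    using Q_trace by (simp add: entry_val_def)
  moreover have "poly_val 2 = scale 2 \<one>"
    using poly_val_single[of 0 2] by (simp del: poly_val_single)
  ultimately show ?thesis
    by (simp add: trel_def poly_val_diff poly_val_sum poly_val_pvar)
qed

text \<open>\<open>poly_val\<close> is multiplicative for the twisted product only, whereas the
  ideal is closed under the ordinary one. Between a monomial and a homogeneous relation the two
  products differ by a nonzero scalar, so the vanishing carries over from one to the other.\<close>

lemma poly_val_ideal:
  assumes "p \<in> cm_ideal"
  shows "poly_val p = 0"
proof -
  have kills: "poly_val (Poly_Mapping.single m c * r) = 0"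
    if r: "poly_val r = 0" "\<And>n. n \<in> Poly_Mapping.keys r \<Longrightarrow> wt n = b" for m c r b
  proof -
    have "poly_tw \<theta> (Poly_Mapping.single m c) r
        = Poly_Mapping.single 0 (F \<theta> (wt m) b) * (Poly_Mapping.single m c * r)"
      by (rule poly_tw_homog) (auto simp: r(2) split: if_splits)
    then have "F \<theta> (wt m) b *s poly_val (Poly_Mapping.single m c * r)
        = poly_val (poly_tw \<theta> (Poly_Mapping.single m c) r)"
      by (simp only: poly_val_scale)
    also have "\<dots> = 0"
      by (simp only: poly_val_tw r(1) mult_zero_right)
    finally show ?thesis by simp
  qed
  have "poly_val p \<in> {0}"
    by (rule ideal_map[OF poly_val_add _ _ _ _ assms])
      (simp_all add: kills[OF poly_val_prel keys_prel] kills[OF poly_val_trel keys_trel])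
  then show ?thesis by simp
qed

definition cm_val :: "cm \<Rightarrow> 'a" where
  "cm_val x = poly_val (rep_cm x)"

lemma cm_val_abs [simp]: "cm_val (abs_cm p) = poly_val p"
proof -
  have "poly_val (rep_cm (abs_cm p) - p) = 0"
    using cm_eq_rep_abs[of p] poly_val_ideal unfolding cm_eq_def by blast
  then show ?thesis by (simp add: cm_val_def poly_val_diff)
qed

lemma star_algebra_hom_cm_val:
  "star_algebra_hom cm_scale (cm_tw \<theta>) 1 cm_star scale (\<odot>) \<one> star cm_val"
proof -
  have "Vector_Spaces.linear cm_scale scale cm_val"
  proof unfold_locales
    fix x y :: cm and c :: complex
    obtain p q where "x = abs_cm p" "y = abs_cm q" by (meson abs_cm_cases)
    then show "cm_val (x + y) = cm_val x + cm_val y" "cm_val (cm_scale c x) = c *s cm_val x"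
      by (simp_all add: plus_cm.abs_eq cm_scale.abs_eq poly_val_add poly_val_scale)
  qed
  moreover have "cm_val (cm_tw \<theta> x y) = cm_val x \<odot> cm_val y" for x y
  proof -
    obtain p q where "x = abs_cm p" "y = abs_cm q" by (meson abs_cm_cases)
    then show ?thesis by (simp add: cm_tw.abs_eq poly_val_tw)
  qed
  moreover have "cm_val (cm_star x) = (cm_val x)\<^sup>\<star>" for x
    by (induction x rule: cm.abs_induct) (simp add: cm_star.abs_eq poly_val_star)
  moreover have "cm_val 1 = \<one>"
    using poly_val_single[of 0 1] by (simp add: one_cm_def del: poly_val_single)
  ultimately show ?thesis by (simp add: star_algebra_hom_def)
qed

lemma cm_val_Phat: "cm_val (cm_Phat \<theta> $ \<mu> $ \<nu>) = Q \<mu> \<nu>"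
  by (simp add: cm_Phat_abs mono_val_single entry_val_def cis_mult del: One_nat_def)

text \<open>The entries of P-hat generate: every monomial is, up to a phase, an iterated twisted
  product of them, and its image obeys the same recursion as \<open>mono_val\<close>.\<close>

lemma cm_val_unique:
  assumes hom: "star_algebra_hom cm_scale (cm_tw \<theta>) 1 cm_star scale (\<odot>) \<one> star \<phi>"
    and Q: "\<And>\<mu> \<nu>. \<phi> (cm_Phat \<theta> $ \<mu> $ \<nu>) = Q \<mu> \<nu>"
  shows "\<phi> = cm_val"
proof -
  have lin: "Vector_Spaces.linear cm_scale scale \<phi>"
    and tw: "\<phi> (cm_tw \<theta> x y) = \<phi> x \<odot> \<phi> y" and one: "\<phi> 1 = \<one>" for x y
    using hom unfolding star_algebra_hom_def by blast+
  have hom_add: "\<phi> (x + y) = \<phi> x + \<phi> y" and scale: "\<phi> (cm_scale c x) = c *s \<phi> x" for x y c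
    using module_hom.add module_hom.scale Vector_Spaces.linear.axioms(3)[OF lin] by blast+
  have entry_val: "\<phi> (abs_cm (Poly_Mapping.single (Poly_Mapping.single i 1) 1)) = entry_val i" for i
  proof -
    have "abs_cm (Poly_Mapping.single (Poly_Mapping.single i 1) 1)
        = cm_scale (cis (\<theta> $ fst i $ snd i)) (cm_Phat \<theta> $ fst i $ snd i)"
      by (simp add: cm_Phat_abs cm_scale.abs_eq mult_single cis_mult del: One_nat_def)
    then show ?thesis by (simp only: scale Q entry_val_def)
  qed
  have mono: "\<phi> (abs_cm (Poly_Mapping.single m 1)) = mono_val m" for m
  proof (induction m rule: mono_induct)
    case zero
    then show ?case using one by (simp add: one_cm_def)
  next
    case (add i m)
    let ?i = "Poly_Mapping.single i (1::nat)"
    have "abs_cm (Poly_Mapping.single (?i + m) 1)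
        = cm_scale (cnj (F \<theta> (wt ?i) (wt m)))
            (cm_tw \<theta> (abs_cm (Poly_Mapping.single ?i 1)) (abs_cm (Poly_Mapping.single m 1)))"
      by (simp add: cm_tw.abs_eq cm_scale.abs_eq mult_single del: One_nat_def)
    then show ?case by (simp only: scale tw entry_val add mono_val_Cons)
  qed
  have "\<phi> (abs_cm p) = poly_val p" for p
  proof (induction p rule: cpoly_induct)
    case (single m c)
    have "abs_cm (Poly_Mapping.single m c) = cm_scale c (abs_cm (Poly_Mapping.single m 1))"
      by (simp add: cm_scale.abs_eq mult_single)
    then show ?case by (simp add: scale mono)
  next
    case (add p q)
    then show ?case using hom_add[of "abs_cm p" "abs_cm q"]
      by (simp add: poly_val_add plus_cm.abs_eq)
  qed
  then show ?thesis
    by (intro ext) (metis abs_cm_cases cm_val_abs)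
qed

lemma ex1_star_algebra_hom:
  "\<exists>!\<phi>. star_algebra_hom cm_scale (cm_tw \<theta>) 1 cm_star scale (\<odot>) \<one> star \<phi> \<and>
     (\<forall>\<mu> \<nu>. \<phi> (cm_Phat \<theta> $ \<mu> $ \<nu>) = Q \<mu> \<nu>)"
  using star_algebra_hom_cm_val cm_val_Phat cm_val_unique by blast

end

text \<open>The block form and its solution for the generators use only linear operations, the unit
  and the star, all of which a homomorphism preserves. Prescribing values on the generators is thus
  the same as prescribing them on the matrix entries.\<close>

lemma star_algebra_hom_gens_iff:
  fixes sc :: "complex \<Rightarrow> 'b::ab_group_add \<Rightarrow> 'b"
  assumes "transpose \<theta> = - \<theta>" and B: "star_algebra sc mul one star"
    and hom: "star_algebra_hom cm_scale (cm_tw \<theta>) 1 cm_star sc mul one star \<phi>"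
  shows "(\<forall>x. \<phi> (gens_of (cm_Phat \<theta>) x) = h x) \<longleftrightarrow>
    (\<forall>\<mu> \<nu>. \<phi> (cm_Phat \<theta> $ \<mu> $ \<nu>) = star_algebra.proj_entry one star h \<mu> \<nu>)"
proof -
  interpret B: star_algebra sc mul one star by (rule B)
  have lin: "Vector_Spaces.linear cm_scale sc \<phi>"
    and one: "\<phi> 1 = one" and star: "\<phi> (cm_star x) = star (\<phi> x)" for x
    using hom unfolding star_algebra_hom_def by blast+
  have add: "\<phi> (x + y) = \<phi> x + \<phi> y" and scale: "\<phi> (cm_scale c x) = sc c (\<phi> x)" for x y c
    using module_hom.add module_hom.scale Vector_Spaces.linear.axioms(3)[OF lin] by blast+
  have diff: "\<phi> (x - y) = \<phi> x - \<phi> y" for x y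
    using add[of "x - y" y] by simp
  let ?g = "gens_of (cm_Phat \<theta>)"
  show ?thesis
  proof
    assume "\<forall>x. \<phi> (?g x) = h x"
    then have h: "h = (\<lambda>x. \<phi> (?g x))" by auto
    have "\<phi> (gen_matrix ?g $ \<mu> $ \<nu>) = B.proj_entry h \<mu> \<nu>" for \<mu> \<nu>
      unfolding gen_matrix_def h using exhaust_4[of \<mu>] exhaust_4[of \<nu>]
      by (auto simp: B.proj_entry_simps add diff star one simp del: gens_of.simps)
    then show "\<forall>\<mu> \<nu>. \<phi> (cm_Phat \<theta> $ \<mu> $ \<nu>) = B.proj_entry h \<mu> \<nu>"
      by (simp add: gen_matrix_gens_of_cm_Phat[OF assms(1)])
  next
    assume *: "\<forall>\<mu> \<nu>. \<phi> (cm_Phat \<theta> $ \<mu> $ \<nu>) = B.proj_entry h \<mu> \<nu>"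
    have half: "sc (1/2) (y + y) = y" for y
      by (simp flip: B.scale_two)
    have "\<phi> (?g x) = h x" for x
      using half[of "h Ga"] half[of "h Galpha3"] half[of "h Gdelta3"]
      by (cases x) (simp_all add: scale add diff * B.proj_entry_simps)
    then show "\<forall>x. \<phi> (?g x) = h x" by blast
  qed
qed

text \<open>Completeness of the list: the values \<open>h\<close> are assembled into a block matrix,
  which is a twisted projector by the converse half of the equivalence.\<close>

lemma cm_tw_universal:
  fixes sc :: "complex \<Rightarrow> 'b::ab_group_add \<Rightarrow> 'b"
  assumes antisym: "transpose \<theta> = - \<theta>" and B: "star_algebra sc mul one star"
    and rel: "star_algebra.cm_relations sc mul one star \<theta> h"
  shows "\<exists>!\<phi>. star_algebra_hom cm_scale (cm_tw \<theta>) 1 cm_star sc mul one star \<phi> \<and>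
    (\<forall>x. \<phi> (gens_of (cm_Phat \<theta>) x) = h x)"
proof -
  interpret B: star_algebra sc mul one star by (rule B)
  interpret twisted_projector sc mul one star \<theta> "B.proj_entry h"
    using B.twisted_projector_iff_cm_relations[OF antisym] rel by blast
  show ?thesis
    using ex1_star_algebra_hom star_algebra_hom_gens_iff[OF antisym B] by (smt (verit))
qed

theorem proposition6p3:
  fixes \<theta> :: "real^4^4"
  assumes "transpose \<theta> = - \<theta>"
    and "\<And>\<mu>. (\<Sum>\<nu>\<in>UNIV. \<theta> $ \<mu> $ \<nu>) = 0"
    and "\<And>\<nu>. (\<Sum>\<mu>\<in>UNIV. \<theta> $ \<mu> $ \<nu>) = 0"
  shows
    "star_algebra cm_scale (cm_tw \<theta>) 1 cm_star
     \<and> gen_matrix (gens_of (cm_Phat \<theta>)) = cm_Phat \<theta>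
     \<and> (\<forall>x\<in>{Ga, Galpha3, Gdelta3}. \<forall>f.
          cm_tw \<theta> (gens_of (cm_Phat \<theta>) x) f = cm_tw \<theta> f (gens_of (cm_Phat \<theta>) x))
     \<and> star_algebra.trivial_relations (cm_tw \<theta>) cm_star (gens_of (cm_Phat \<theta>))
     \<and> star_algebra.commutation_relations cm_scale (cm_tw \<theta>) cm_star \<theta> (gens_of (cm_Phat \<theta>))
     \<and> star_algebra.projector_relations cm_scale (cm_tw \<theta>) 1 cm_star (gens_of (cm_Phat \<theta>))
     \<and> star_algebra.matrix_relations cm_scale (cm_tw \<theta>) cm_star \<theta> (gens_of (cm_Phat \<theta>))
     \<and> (\<forall>(sc :: complex \<Rightarrow> 'b::ab_group_add \<Rightarrow> 'b) mul one star (h :: gen \<Rightarrow> 'b).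
          star_algebra sc mul one star \<and>
          star_algebra.cm_relations sc mul one star \<theta> h \<longrightarrow>
          (\<exists>!\<phi>. star_algebra_hom cm_scale (cm_tw \<theta>) 1 cm_star sc mul one star \<phi> \<and>
                (\<forall>x. \<phi> (gens_of (cm_Phat \<theta>) x) = h x)))
     \<and> star_algebra cm_scale (*) 1 cm_star
     \<and> gen_matrix (gens_of cm_P) = cm_P
     \<and> star_algebra.trivial_relations (*) cm_star (gens_of cm_P)
     \<and> star_algebra.projector_relations cm_scale (*) 1 cm_star (gens_of cm_P)
     \<and> star_algebra.matrix_relations cm_scale (*) cm_star 0 (gens_of cm_P)
     \<and> (\<forall>(sc :: complex \<Rightarrow> 'b::ab_group_add \<Rightarrow> 'b) mul one star (h :: gen \<Rightarrow> 'b).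
          star_algebra sc mul one star \<and>
          star_algebra.cm_relations sc mul one star 0 h \<longrightarrow>
          (\<exists>!\<phi>. star_algebra_hom cm_scale (*) 1 cm_star sc mul one star \<phi> \<and>
                (\<forall>x. \<phi> (gens_of cm_P x) = h x)))"
proof (intro conjI)
  have zero: "transpose 0 = - (0 :: real^4^4)"
    by (simp add: transpose_def vec_eq_iff)
  interpret tw: star_algebra cm_scale "cm_tw \<theta>" 1 cm_star
    by (rule star_algebra_cm_tw[OF assms(1)])
  show "star_algebra cm_scale (cm_tw \<theta>) 1 cm_star"
    by unfold_locales
  show "gen_matrix (gens_of (cm_Phat \<theta>)) = cm_Phat \<theta>"
    by (rule gen_matrix_gens_of_cm_Phat[OF assms(1)])
  show "\<forall>x\<in>{Ga, Galpha3, Gdelta3}. \<forall>f.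
      cm_tw \<theta> (gens_of (cm_Phat \<theta>) x) f = cm_tw \<theta> f (gens_of (cm_Phat \<theta>) x)"
    using gens_of_cm_Phat_central[OF assms(1)] by blast
  show "tw.trivial_relations (gens_of (cm_Phat \<theta>))"
    "tw.commutation_relations \<theta> (gens_of (cm_Phat \<theta>))"
    "tw.projector_relations (gens_of (cm_Phat \<theta>))"
    "tw.matrix_relations \<theta> (gens_of (cm_Phat \<theta>))"
    using cm_relations_gens_of_cm_Phat[OF assms(1)] unfolding tw.cm_relations_def by blast+
  show "\<forall>(sc :: complex \<Rightarrow> 'b::ab_group_add \<Rightarrow> 'b) mul one star (h :: gen \<Rightarrow> 'b).
      star_algebra sc mul one star \<and> star_algebra.cm_relations sc mul one star \<theta> h \<longrightarrow>
      (\<exists>!\<phi>. star_algebra_hom cm_scale (cm_tw \<theta>) 1 cm_star sc mul one star \<phi> \<and>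
        (\<forall>x. \<phi> (gens_of (cm_Phat \<theta>) x) = h x))"
    using cm_tw_universal[OF assms(1)] by blast
  interpret classical: star_algebra cm_scale "(*)" 1 cm_star
    using star_algebra_cm_tw[OF zero] by (simp only: cm_tw_zero)
  show "star_algebra cm_scale (*) 1 cm_star"
    by unfold_locales
  show "gen_matrix (gens_of cm_P) = cm_P"
    using gen_matrix_gens_of_cm_Phat[OF zero] by (simp only: cm_Phat_zero)
  show "classical.trivial_relations (gens_of cm_P)"
    "classical.projector_relations (gens_of cm_P)"
    "classical.matrix_relations 0 (gens_of cm_P)"
    using cm_relations_gens_of_cm_Phat[OF zero]
    unfolding cm_tw_zero cm_Phat_zero classical.cm_relations_def by blast+
  show "\<forall>(sc :: complex \<Rightarrow> 'b::ab_group_add \<Rightarrow> 'b) mul one star (h :: gen \<Rightarrow> 'b).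
      star_algebra sc mul one star \<and> star_algebra.cm_relations sc mul one star 0 h \<longrightarrow>
      (\<exists>!\<phi>. star_algebra_hom cm_scale (*) 1 cm_star sc mul one star \<phi> \<and>
        (\<forall>x. \<phi> (gens_of cm_P x) = h x))"
    using cm_tw_universal[OF zero] unfolding cm_tw_zero cm_Phat_zero by blast
qed

end
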